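(* Let $(u,p)$ be a weak solution of the Euler equations on $D_+\times[0,T]$. Then the extension $u_E$ is a weak solution of the Euler equations on $D=\mathbb{T}^2\times\mathbb{R}$ on the time interval $[0,T]$.
   Context: $T>0$ is fixed, $\mathbb{T}=\mathbb{R}/2\pi\mathbb{Z}$, $D:=\mathbb{T}^2\times\mathbb{R}$, $D_+:=\mathbb{T}^2\times[0,\infty)$, $D_-:=\mathbb{T}^2\times(-\infty,0]$, and $\partial D_+=\{x_3=0\}$ with normal $n=(0,0,-1)$, so $\phi\cdot n=-\phi_3$. $\mathcal{S}(D)$ is the set of $C^\infty$ functions $\phi$ with $\sup_x|\partial^\alpha\phi(x)||x_3|^k<\infty$ for all multi-indices $\alpha$ and all $k\ge0$; $\mathcal{D}(D)$ is the set of $C^\infty$ functions with compact support in $D$; $\mathcal{S}_\sigma(D)$, $\mathcal{D}_\sigma(D)$ are the sets of divergence-free vector fields in them. $\mathcal{S}(D_+)$ and $\mathcal{S}_\sigma(D_+)$ are the sets of restrictions to $D_+$ of elements of $\mathcal{S}(D)$ and $\mathcal{S}_\sigma(D)$. $H_\sigma(D)$ is the closure of $\mathcal{D}_\sigma(D)$ (equivalently of $\mathcal{S}_\sigma(D)$) in $L^2(D)$. $H_\sigma(D_+)$ is the completion in the norm of $L^2(D_+)$ of $\{\phi\in\mathcal{S}(D_+):\nabla\cdot\phi=0,\ \phi_3=0\text{ on }\partial D_+\}$ (vector-valued $\phi$); equivalently, of the smooth divergence-free fields with compact support in the interior of $D_+$. For $\Omega\in\{D,D_+\}$, $C_{\rm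 w}([0,T];H_\sigma(\Omega))$ is the set of $u:[0,T]\to H_\sigma(\Omega)$ such that $t\mapsto\langle u(t),\phi\rangle_\Omega$ is continuous for every $\phi\in L^2(\Omega)$, and $\mathcal{S}_\sigma^T(\Omega):=\{\psi\in C^\infty(\Omega\times[0,T]):\psi(\cdot,t)\in\mathcal{S}_\sigma(\Omega)\text{ for every }t\in[0,T]\}$. Notation: $\langle f,g\rangle_\Omega=\int_\Omega f_ig_i\,dx$ and $\langle F:G\rangle_\Omega=\int_\Omega F_{ij}G_{ij}\,dx$ (summation convention); $\langle p,g\rangle_{\partial D_+\times[0,t]}$ is the pairing of the boundary distribution $p$ with $g$ over $\partial D_+\times[0,t]$ (for smooth $p$ it is $\int_0^t\int_{\partial D_+}pg\,dS\,d\tau$). Weak solution on $D_+\times[0,T]$: a pair $(u,p)$ with $u\in C_{\rm w}([0,T];H_\sigma(D_+))$ and $p\in\mathcal{D}'(\partial D_+\times[0,T])$ such that $$\langle u(t),\phi(t)\rangle_{D_+}-\langle u(0),\phi(0)\rangle_{D_+}-\int_0^t\langle u(\tau),\partial_t\phi(\tau)\rangle_{D_+}d\tau=\int_0^t\langle u(\tau)\otimes u(\tau):\nabla\phi(\tau)\rangle_{D_+}d\tau-\langle p,\phi\cdot n\rangle_{\partial D_+\times[0,t]}$$ for every $t\in[0,T]$ and every $\phi\in\mathcal{S}_\sigma^T(D_+)$. Weak solution on $D$: $v\in C_{\rm w}([0,T];H_\sigma(D))$ such that $$\langle v(t),\psi(t)\rangle_D-\langle v(0),\psi(0)\rangle_D-\int_0^t\langle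 v(\tau),\partial_t\psi(\tau)\rangle_D\,d\tau=\int_0^t\langle v(\tau)\otimes v(\tau):\nabla\psi(\tau)\rangle_D\,d\tau$$ for every $t\in[0,T]$ and every $\psi\in\mathcal{S}_\sigma^T(D)$. Reflection and extension: for $f:D_+\to\mathbb{R}^3$, $f_R:D_-\to\mathbb{R}^3$ is $f_R(x,y,z):=(f_1(x,y,-z),f_2(x,y,-z),-f_3(x,y,-z))$. Extending $f$ and $f_R$ by zero outside their domains, $f_E:=f+f_R$ for $z\ne0$ and $f_E(x,y,0):=(f_1(x,y,0),f_2(x,y,0),0)$. For time-dependent fields these are applied at each time. *)

theory Defs
  imports "HOL-Analysis.Analysis"
begin

subsection \<open>Smooth functions\<close>

definition deriv_along ::
  "'a::real_normed_vector \<Rightarrow> ('a \<Rightarrow> 'b::real_normed_vector) \<Rightarrow> 'a \<Rightarrow> 'b" where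
  "deriv_along v f x = frechet_derivative f (at x) v"

(* Multi-indices are lists of basis vectors. *)
definition iter_deriv ::
  "'a::real_normed_vector list \<Rightarrow> ('a \<Rightarrow> 'b::real_normed_vector) \<Rightarrow> 'a \<Rightarrow> 'b" where
  "iter_deriv vs f = foldr deriv_along vs f"

definition smooth :: "('a::euclidean_space \<Rightarrow> 'b::real_normed_vector) \<Rightarrow> bool" where
  "smooth f \<longleftrightarrow> (\<forall>vs\<in>lists Basis. \<forall>x. iter_deriv vs f differentiable (at x))"

definition divergence :: "(real^3 \<Rightarrow> real^3) \<Rightarrow> real^3 \<Rightarrow> real" where
  "divergence f x = (\<Sum>i\<in>UNIV. deriv_along (axis i 1) f x $ i)"


subsection \<open>The domains\<close>

(* Functions on T^2 x R are functions on R^3 that are 2 pi-periodic in the first two variables.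
   A subset Omega of T^2 x R is represented by its preimage in R^3, and integrals over it
   are taken over one period cell. *)

definition periodic_on :: "'a::plus set \<Rightarrow> 'a set \<Rightarrow> ('a \<Rightarrow> 'b) \<Rightarrow> bool" where
  "periodic_on S P f \<longleftrightarrow> (\<forall>v\<in>P. \<forall>x\<in>S. f (x + v) = f x)"

definition periods :: "(real^3) set" where
  "periods = {axis 1 (2 * pi), axis 2 (2 * pi)}"

definition boundary_periods :: "(real^2) set" where
  "boundary_periods = {axis 1 (2 * pi), axis 2 (2 * pi)}"

definition D_full :: "(real^3) set" where
  "D_full = UNIV"

definition D_plus :: "(real^3) set" where
  "D_plus = {x. 0 \<le> x $ 3}"

definition D_minus :: "(real^3) set" where
  "D_minus = {x. x $ 3 \<le> 0}"

definition cell :: "(real^3) set" where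
  "cell = {x. 0 \<le> x $ 1 \<and> x $ 1 < 2 * pi \<and> 0 \<le> x $ 2 \<and> x $ 2 < 2 * pi}"

definition vol :: "(real^3) set \<Rightarrow> (real^3) measure" where
  "vol \<Omega> = lebesgue_on (\<Omega> \<inter> cell)"

definition boundary_point :: "real^2 \<Rightarrow> real^3" where
  "boundary_point y = vector [y $ 1, y $ 2, 0]"

definition outer_normal :: "real^3" where
  "outer_normal = vector [0, 0, -1]"


subsection \<open>Spaces of vector fields\<close>

definition schwartz :: "(real^3 \<Rightarrow> real^3) set" where
  "schwartz = {\<phi>. smooth \<phi> \<and> periodic_on UNIV periods \<phi> \<and>
     (\<forall>vs\<in>lists Basis. \<forall>k::nat. \<exists>C. \<forall>x. norm (iter_deriv vs \<phi> x) * \<bar>x $ 3\<bar> ^ k \<le> C)}"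

(* As T^2 is compact, a support is compact iff it is bounded in the third variable. *)
definition test_fields :: "(real^3 \<Rightarrow> real^3) set" where
  "test_fields = {\<phi>. smooth \<phi> \<and> periodic_on UNIV periods \<phi> \<and>
     (\<exists>R. \<forall>x. R < \<bar>x $ 3\<bar> \<longrightarrow> \<phi> x = 0)}"

definition test_fields_sol :: "(real^3 \<Rightarrow> real^3) set" where
  "test_fields_sol = {\<phi> \<in> test_fields. \<forall>x. divergence \<phi> x = 0}"

(* Fields on a subset of R^3 are total functions of which only the values on that subset matter:
   this is S_sigma(D) for D_full, and the restrictions to D_plus of its elements for D_plus. *)
definition schwartz_sol :: "(real^3) set \<Rightarrow> (real^3 \<Rightarrow> real^3) set" where
  "schwartz_sol \<Omega> = {\<phi>. \<exists>\<Phi>\<in>schwartz. (\<forall>x. divergence \<Phi> x = 0) \<and> (\<forall>x\<in>\<Omega>. \<phi> x = \<Phi> x)}"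

definition L2 :: "(real^3) set \<Rightarrow> (real^3 \<Rightarrow> real^3) set" where
  "L2 \<Omega> = {f. periodic_on \<Omega> periods f \<and> f \<in> borel_measurable (vol \<Omega>) \<and>
     integrable (vol \<Omega>) (\<lambda>x. (norm (f x))\<^sup>2)}"

definition L2_norm :: "(real^3) set \<Rightarrow> (real^3 \<Rightarrow> real^3) \<Rightarrow> real" where
  "L2_norm \<Omega> f = sqrt (\<integral>x. (norm (f x))\<^sup>2 \<partial>vol \<Omega>)"

definition L2_inner :: "(real^3) set \<Rightarrow> (real^3 \<Rightarrow> real^3) \<Rightarrow> (real^3 \<Rightarrow> real^3) \<Rightarrow> real" where
  "L2_inner \<Omega> f g = (\<integral>x. f x \<bullet> g x \<partial>vol \<Omega>)"

definition L2_closure ::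
  "(real^3) set \<Rightarrow> (real^3 \<Rightarrow> real^3) set \<Rightarrow> (real^3 \<Rightarrow> real^3) set" where
  "L2_closure \<Omega> A = {f \<in> L2 \<Omega>. \<forall>e>0. \<exists>g\<in>A. L2_norm \<Omega> (\<lambda>x. f x - g x) < e}"

definition H_full :: "(real^3 \<Rightarrow> real^3) set" where
  "H_full = L2_closure D_full test_fields_sol"

(* The completion is realised as the closure in L2. *)
definition H_plus :: "(real^3 \<Rightarrow> real^3) set" where
  "H_plus = L2_closure D_plus
     {\<phi> \<in> schwartz. (\<forall>x\<in>D_plus. divergence \<phi> x = 0) \<and> (\<forall>x. x $ 3 = 0 \<longrightarrow> \<phi> x $ 3 = 0)}"

definition weakly_continuous ::
  "(real^3) set \<Rightarrow> (real^3 \<Rightarrow> real^3) set \<Rightarrow> real \<Rightarrow> (real \<Rightarrow> real^3 \<Rightarrow> real^3) \<Rightarrow> bool" where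
  "weakly_continuous \<Omega> H T u \<longleftrightarrow> (\<forall>t\<in>{0..T}. u t \<in> H) \<and>
     (\<forall>\<phi>\<in>L2 \<Omega>. continuous_on {0..T} (\<lambda>t. L2_inner \<Omega> (u t) \<phi>))"

(* Smoothness on the closed set Omega x [0,T] means having a smooth extension; the fields below
   are such extensions, and only their values on Omega x [0,T] enter the weak formulations. *)
definition spacetime_tests ::
  "(real^3) set \<Rightarrow> real \<Rightarrow> ((real^3) \<times> real \<Rightarrow> real^3) set" where
  "spacetime_tests \<Omega> T = {\<psi>. smooth \<psi> \<and> periodic_on UNIV ((\<lambda>v. (v, 0)) ` periods) \<psi> \<and>
     (\<forall>t\<in>{0..T}. (\<lambda>x. \<psi> (x, t)) \<in> schwartz_sol \<Omega>)}"


subsection \<open>Distributions on the boundary\<close>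

definition boundary_tests :: "((real^2) \<times> real \<Rightarrow> real) set" where
  "boundary_tests = {g. smooth g \<and> periodic_on UNIV ((\<lambda>v. (v, 0)) ` boundary_periods) g}"

(* T^2 x [0,T] is compact, so its distributions are the continuous linear functionals on
   all smooth functions. The estimate makes p g depend only on g restricted to T^2 x [0,T]. *)
definition boundary_distribution :: "real \<Rightarrow> (((real^2) \<times> real \<Rightarrow> real) \<Rightarrow> real) \<Rightarrow> bool" where
  "boundary_distribution T p \<longleftrightarrow>
     (\<forall>g\<in>boundary_tests. \<forall>h\<in>boundary_tests. \<forall>a b. p (\<lambda>z. a * g z + b * h z) = a * p g + b * p h) \<and>
     (\<exists>C N. \<forall>g\<in>boundary_tests. \<forall>B.
        (\<forall>vs\<in>lists Basis. length vs \<le> N \<longrightarrow> (\<forall>y. \<forall>\<tau>\<in>{0..T}. \<bar>iter_deriv vs g (y, \<tau>)\<bar> \<le> B))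
        \<longrightarrow> \<bar>p g\<bar> \<le> C * B)"

(* Smooth approximations of the indicator function of [0,t] on nonnegative times *)
definition time_cutoffs :: "real \<Rightarrow> (nat \<Rightarrow> real \<Rightarrow> real) \<Rightarrow> bool" where
  "time_cutoffs t \<eta> \<longleftrightarrow> (\<forall>n. smooth (\<eta> n) \<and> antimono (\<eta> n) \<and> (\<forall>s\<le>t. \<eta> n s = 1)) \<and>
     (\<forall>s>t. (\<lambda>n. \<eta> n s) \<longlonglongrightarrow> 0)"

(* The value L of the pairing of p with g over T^2 x [0,t]: the limit of p against g cut off
   in time. It equals p g for t = T, and the integral over T^2 x [0,t] for smooth p. *)
definition has_boundary_pairing ::
  "(((real^2) \<times> real \<Rightarrow> real) \<Rightarrow> real) \<Rightarrow> ((real^2) \<times> real \<Rightarrow> real) \<Rightarrow> real \<Rightarrow> real \<Rightarrow> bool" where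
  "has_boundary_pairing p g t L \<longleftrightarrow>
     (\<forall>\<eta>. time_cutoffs t \<eta> \<longrightarrow> (\<lambda>n. p (\<lambda>(y, \<tau>). \<eta> n \<tau> * g (y, \<tau>))) \<longlonglongrightarrow> L)"

definition normal_trace :: "((real^3) \<times> real \<Rightarrow> real^3) \<Rightarrow> (real^2) \<times> real \<Rightarrow> real" where
  "normal_trace \<phi> = (\<lambda>(y, \<tau>). \<phi> (boundary_point y, \<tau>) \<bullet> outer_normal)"


subsection \<open>Weak solutions of the Euler equations\<close>

(* The iterated integral of F over [0,t] and Omega exists as a Lebesgue integral and equals I.
   Existence is stated because the test fields need not decay uniformly in time, so that
   convergence is not automatic, and the integral operator is 0 where it fails. *)
definition has_iterated_integral ::
  "(real^3) set \<Rightarrow> real \<Rightarrow> (real \<Rightarrow> real^3 \<Rightarrow> real) \<Rightarrow> real \<Rightarrow> bool" where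
  "has_iterated_integral \<Omega> t F I \<longleftrightarrow>
     (AE \<tau> in lebesgue_on {0..t}. integrable (vol \<Omega>) (F \<tau>)) \<and>
     has_bochner_integral (lebesgue_on {0..t}) (\<lambda>\<tau>. \<integral>x. F \<tau> x \<partial>vol \<Omega>) I"

definition time_term ::
  "(real \<Rightarrow> real^3 \<Rightarrow> real^3) \<Rightarrow> ((real^3) \<times> real \<Rightarrow> real^3) \<Rightarrow> real \<Rightarrow> real^3 \<Rightarrow> real" where
  "time_term u \<phi> \<tau> x = u \<tau> x \<bullet> deriv_along (0, 1) \<phi> (x, \<tau>)"

definition convection_term ::
  "(real \<Rightarrow> real^3 \<Rightarrow> real^3) \<Rightarrow> ((real^3) \<times> real \<Rightarrow> real^3) \<Rightarrow> real \<Rightarrow> real^3 \<Rightarrow> real" where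
  "convection_term u \<phi> \<tau> x =
     (\<Sum>i\<in>UNIV. \<Sum>j\<in>UNIV. (u \<tau> x $ i * u \<tau> x $ j) * deriv_along (axis i 1) (\<lambda>x. \<phi> (x, \<tau>)) x $ j)"

definition weak_Euler_solution_plus ::
  "real \<Rightarrow> (real \<Rightarrow> real^3 \<Rightarrow> real^3) \<Rightarrow> (((real^2) \<times> real \<Rightarrow> real) \<Rightarrow> real) \<Rightarrow> bool" where
  "weak_Euler_solution_plus T u p \<longleftrightarrow>
     weakly_continuous D_plus H_plus T u \<and> boundary_distribution T p \<and>
     (\<forall>t\<in>{0..T}. \<forall>\<phi>\<in>spacetime_tests D_plus T. \<exists>I J L.
        has_iterated_integral D_plus t (time_term u \<phi>) I \<and>
        has_iterated_integral D_plus t (convection_term u \<phi>) J \<and>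
        has_boundary_pairing p (normal_trace \<phi>) t L \<and>
        L2_inner D_plus (u t) (\<lambda>x. \<phi> (x, t)) - L2_inner D_plus (u 0) (\<lambda>x. \<phi> (x, 0)) - I = J - L)"

definition weak_Euler_solution_full ::
  "real \<Rightarrow> (real \<Rightarrow> real^3 \<Rightarrow> real^3) \<Rightarrow> bool" where
  "weak_Euler_solution_full T v \<longleftrightarrow>
     weakly_continuous D_full H_full T v \<and>
     (\<forall>t\<in>{0..T}. \<forall>\<psi>\<in>spacetime_tests D_full T. \<exists>I J.
        has_iterated_integral D_full t (time_term v \<psi>) I \<and>
        has_iterated_integral D_full t (convection_term v \<psi>) J \<and>
        L2_inner D_full (v t) (\<lambda>x. \<psi> (x, t)) - L2_inner D_full (v 0) (\<lambda>x. \<psi> (x, 0)) - I = J)"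


subsection \<open>Reflection and extension\<close>

definition reflect_field :: "(real^3 \<Rightarrow> real^3) \<Rightarrow> real^3 \<Rightarrow> real^3" where
  "reflect_field f x =
     (let w = f (vector [x $ 1, x $ 2, - x $ 3]) in vector [w $ 1, w $ 2, - w $ 3])"

definition zero_extend :: "(real^3) set \<Rightarrow> (real^3 \<Rightarrow> real^3) \<Rightarrow> real^3 \<Rightarrow> real^3" where
  "zero_extend S f x = (if x \<in> S then f x else 0)"

definition extend_field :: "(real^3 \<Rightarrow> real^3) \<Rightarrow> real^3 \<Rightarrow> real^3" where
  "extend_field f x =
     (if x $ 3 \<noteq> 0 then zero_extend D_plus f x + zero_extend D_minus (reflect_field f) x
      else vector [f x $ 1, f x $ 2, 0])"

end

(* A weak solution on the half space is tested with psi + psi_R, where psi_R is the reflection of a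
   test field psi on the whole space. The normal component of this sum vanishes on the boundary, so
   the pressure term drops out, and by the change of variables z -> -z every integral of u against
   psi + psi_R over the half space is the integral of u_E against psi over the whole space. Testing
   with psi and psi_R separately gives the integrability on the two halves.

   That u_E(t) lies in H_sigma(D) rests on an approximation: a divergence-free g with g_3 = 0 on the
   boundary is cut off by chi(x_3), which vanishes near x_3 = 0 and near infinity, and the divergence
   chi' g_3 is compensated by the horizontal field chi' (int_0^{x_3} g ds), which is small in L^2
   because x_3 chi' is bounded. The result vanishes near the boundary, so adding its reflection gives
   a smooth compactly supported solenoidal field. *)
theory Submission
  imports Defs
begin


section \<open>Smooth functions\<close>

text \<open>The extension of a smooth g with g_3 = 0 on the boundary is continuous, but normal
  derivatives such as d_3 g_1 may jump across the plane. It is therefore not a smooth solenoidal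
  field in general, and the approximants must be flat near the boundary. The cutoff chi rises near z
  = 1/m and falls near z = m, so chi' has size m near the boundary. Both transitions are dilations
  of one step, and z chi'(z) is dilation invariant, hence bounded uniformly in m. This is why the
  vertical integral of g is written as x_3 times an average over the unit segment: the factor x_3 is
  absorbed by chi', and the average is smooth on all of R^3 without a division by x_3. A bound
  C/(1+z)^2 for g gives C/(1+z) for the average, whose square is still integrable, so a single
  majorant serves all m and dominated convergence applies. The boundary pairing is a limit along
  every sequence of time cutoffs. It determines its value only because such sequences exist, so one
  is constructed.\<close>

lemma deriv_along_eq: "(f has_derivative f') (at x) \<Longrightarrow> deriv_along v f x = f' v"
  unfolding deriv_along_def by (metis frechet_derivative_at)

text \<open>Here the innermost derivative is peeled off first, whereas the head of the list in
  \<open>iter_deriv\<close> is the outermost one. Closure properties then follow by induction on the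
  order with the function arbitrary: only the formula for a first derivative is required.\<close>

primrec n_smooth :: "nat \<Rightarrow> ('a::euclidean_space \<Rightarrow> 'b::real_normed_vector) \<Rightarrow> bool" where
  "n_smooth 0 f \<longleftrightarrow> (\<forall>x. f differentiable at x)"
| "n_smooth (Suc n) f \<longleftrightarrow> (\<forall>x. f differentiable at x) \<and> (\<forall>v\<in>Basis. n_smooth n (deriv_along v f))"

lemma n_smooth_differentiable: "n_smooth n f \<Longrightarrow> f differentiable at x"
  by (cases n) auto

lemma n_smooth_Suc_imp: "n_smooth (Suc n) f \<Longrightarrow> n_smooth n f"
  by (induction n arbitrary: f) auto

lemma iter_deriv_Nil [simp]: "iter_deriv [] f = f"
  by (simp add: iter_deriv_def)

lemma iter_deriv_Cons: "iter_deriv (v # vs) f = deriv_along v (iter_deriv vs f)"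
  by (simp add: iter_deriv_def)

lemma iter_deriv_snoc: "iter_deriv (vs @ [v]) f = iter_deriv vs (deriv_along v f)"
  by (simp add: iter_deriv_def)

text \<open>The derivative taken first is the last entry of the list, hence the case split at the
  end of the list.\<close>

lemma n_smooth_iff_iter_deriv:
  "n_smooth n f \<longleftrightarrow> (\<forall>vs\<in>lists Basis. length vs \<le> n \<longrightarrow> (\<forall>x. iter_deriv vs f differentiable (at x)))"
proof (induction n arbitrary: f)
  case (Suc n)
  show ?case
  proof
    assume f: "n_smooth (Suc n) f"
    show "\<forall>vs\<in>lists Basis. length vs \<le> Suc n \<longrightarrow> (\<forall>x. iter_deriv vs f differentiable (at x))"
    proof (intro ballI impI allI)
      fix vs :: "'a list" and x assume vs: "vs \<in> lists Basis" "length vs \<le> Suc n"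
      show "iter_deriv vs f differentiable (at x)"
      proof (cases vs rule: rev_cases)
        case Nil
        then show ?thesis using f by simp
      next
        case (snoc ws w)
        then show ?thesis using f vs Suc.IH by (auto simp: iter_deriv_snoc)
      qed
    qed
  next
    assume r: "\<forall>vs\<in>lists Basis. length vs \<le> Suc n \<longrightarrow> (\<forall>x. iter_deriv vs f differentiable (at x))"
    have "n_smooth n (deriv_along v f)" if v: "v \<in> Basis" for v
      unfolding Suc.IH
    proof (intro ballI impI allI)
      fix vs :: "'a list" and x assume "vs \<in> lists Basis" "length vs \<le> n"
      then show "iter_deriv vs (deriv_along v f) differentiable (at x)"
        using r[rule_format, of "vs @ [v]" x] v by (simp add: iter_deriv_snoc)
    qed
    moreover have "f differentiable at x" for x
      using r[rule_format, of "[]" x] by simp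
    ultimately show "n_smooth (Suc n) f" by simp
  qed
qed auto

lemma smooth_iff_n_smooth: "smooth f \<longleftrightarrow> (\<forall>n. n_smooth n f)"
  unfolding n_smooth_iff_iter_deriv smooth_def by auto

lemma smooth_differentiable: "smooth f \<Longrightarrow> f differentiable at x"
  using smooth_iff_n_smooth n_smooth_differentiable by blast

lemma smooth_deriv_along: "smooth f \<Longrightarrow> v \<in> Basis \<Longrightarrow> smooth (deriv_along v f)"
  unfolding smooth_iff_n_smooth by (metis n_smooth.simps(2))

lemma smooth_iter_deriv: "smooth f \<Longrightarrow> vs \<in> lists Basis \<Longrightarrow> smooth (iter_deriv vs f)"
  by (induction vs) (auto simp: iter_deriv_Cons smooth_deriv_along)

lemma smooth_has_derivative:
  "smooth f \<Longrightarrow> (f has_derivative (\<lambda>v. deriv_along v f x)) (at x)"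
  unfolding deriv_along_def using smooth_differentiable frechet_derivative_works by blast

lemma differentiable_has_derivative_along:
  "f differentiable at x \<Longrightarrow> (f has_derivative (\<lambda>v. deriv_along v f x)) (at x)"
  unfolding deriv_along_def using frechet_derivative_works by blast

lemma smooth_continuous_on: "smooth f \<Longrightarrow> continuous_on S f"
  by (meson smooth_differentiable differentiable_at_withinI differentiable_imp_continuous_on differentiable_on_def)

text \<open>Smoothness controls derivatives along basis vectors only, while the chain rule produces
  arbitrary directions; this expansion reduces the latter to the former.\<close>

lemma deriv_along_sum_Basis:
  assumes "f differentiable at x"
  shows "deriv_along v f x = (\<Sum>b\<in>Basis. (v \<bullet> b) *\<^sub>R deriv_along b f x)"
proof -
  interpret bounded_linear "\<lambda>v. deriv_along v f x"
    using differentiable_has_derivative_along[OF assms] has_derivative_bounded_linear by blast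
  show ?thesis
    by (subst euclidean_representation[of v, symmetric]) (simp add: sum scaleR)
qed

section \<open>Closure of finite-order smoothness under algebraic operations and composition\<close>

lemma n_smooth_const: "n_smooth n (\<lambda>x. c)"
proof (induction n arbitrary: c)
  case (Suc n)
  have "deriv_along v (\<lambda>x::'a. c) = (\<lambda>x. 0)" for v
    by (rule ext) (rule deriv_along_eq[OF has_derivative_const])
  then show ?case using Suc by simp
qed simp

lemma n_smooth_add: "n_smooth n f \<Longrightarrow> n_smooth n g \<Longrightarrow> n_smooth n (\<lambda>x. f x + g x)"
proof (induction n arbitrary: f g)
  case (Suc n)
  have "deriv_along v (\<lambda>x. f x + g x) = (\<lambda>x. deriv_along v f x + deriv_along v g x)" for v
    by (rule ext, rule deriv_along_eq[OF has_derivative_add])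
      (use Suc.prems in \<open>auto intro: differentiable_has_derivative_along\<close>)
  then show ?case using Suc by simp
qed simp

lemma n_smooth_sum: "(\<And>i. i \<in> I \<Longrightarrow> n_smooth n (f i)) \<Longrightarrow> n_smooth n (\<lambda>x. \<Sum>i\<in>I. f i x)"
  by (induction I rule: infinite_finite_induct) (auto simp: n_smooth_const n_smooth_add)

text \<open>By the Leibniz rule the derivative is a sum of two products of the same kind; the
  undifferentiated factor is lowered by one order so that the induction hypothesis applies. Scalar
  multiples and real products are instances.\<close>

lemma n_smooth_bilinear:
  assumes "bounded_bilinear B"
  shows "n_smooth n f \<Longrightarrow> n_smooth n g \<Longrightarrow> n_smooth n (\<lambda>x. B (f x) (g x))"
proof (induction n arbitrary: f g)
  case 0
  then show ?case
    unfolding n_smooth.simps differentiable_def by (blast dest: bounded_bilinear.FDERIV[OF assms])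
next
  case (Suc n)
  have D: "((\<lambda>x. B (f x) (g x)) has_derivative (\<lambda>v. B (f x) (deriv_along v g x) + B (deriv_along v f x) (g x))) (at x)" for x
    by (rule bounded_bilinear.FDERIV[OF assms])
      (use Suc.prems in \<open>auto intro: differentiable_has_derivative_along\<close>)
  have "deriv_along v (\<lambda>x. B (f x) (g x)) = (\<lambda>x. B (f x) (deriv_along v g x) + B (deriv_along v f x) (g x))" for v
    by (rule ext) (rule deriv_along_eq[OF D])
  moreover have "n_smooth n f" "n_smooth n g"
    using Suc.prems n_smooth_Suc_imp by blast+
  ultimately show ?case
    using differentiableI[OF D] Suc.prems Suc.IH by (auto intro!: n_smooth_add)
qed

text \<open>The derivative is a combination, with constant coefficients, of basis derivatives of f
  composed with the same affine map, so the induction closes.\<close>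

lemma n_smooth_compose_affine:
  assumes L: "bounded_linear L"
  shows "n_smooth n f \<Longrightarrow> n_smooth n (\<lambda>x. f (L x + c))"
proof (induction n arbitrary: f)
  case 0
  have "((\<lambda>x. f (L x + c)) has_derivative (\<lambda>v. deriv_along (L v) f (L x + c))) (at x)" for x
    by (rule has_derivative_compose[of "\<lambda>x. L x + c" L])
      (use 0 in \<open>auto intro!: derivative_eq_intros bounded_linear_imp_has_derivative[OF L] intro: differentiable_has_derivative_along\<close>)
  then show ?case unfolding n_smooth.simps differentiable_def by blast
next
  case (Suc n)
  have D: "((\<lambda>x. f (L x + c)) has_derivative (\<lambda>v. deriv_along (L v) f (L x + c))) (at x)" for x
    by (rule has_derivative_compose[of "\<lambda>x. L x + c" L])
      (use Suc.prems in \<open>auto intro!: derivative_eq_intros bounded_linear_imp_has_derivative[OF L] intro: differentiable_has_derivative_along\<close>)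
  have "deriv_along v (\<lambda>x. f (L x + c)) = (\<lambda>x. \<Sum>b\<in>Basis. (L v \<bullet> b) *\<^sub>R deriv_along b f (L x + c))" for v
    by (rule ext, subst deriv_along_eq[OF D], rule deriv_along_sum_Basis)
      (use Suc.prems in auto)
  then show ?case
    using differentiableI[OF D] Suc by (auto intro!: n_smooth_sum n_smooth_bilinear[OF bounded_bilinear_scaleR] n_smooth_const)
qed

text \<open>With a real-valued inner function the chain rule has a single term, a product handled by
  the bilinear case.\<close>

lemma n_smooth_compose_real:
  fixes h :: "real \<Rightarrow> 'b::real_normed_vector"
  shows "n_smooth n h \<Longrightarrow> n_smooth n g \<Longrightarrow> n_smooth n (\<lambda>x. h (g x))"
proof (induction n arbitrary: h g)
  case 0
  have "((\<lambda>x. h (g x)) has_derivative (\<lambda>v. deriv_along (deriv_along v g x) h (g x))) (at x)" for x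
    by (rule has_derivative_compose) (use 0 in \<open>auto intro: differentiable_has_derivative_along\<close>)
  then show ?case unfolding n_smooth.simps differentiable_def by blast
next
  case (Suc n)
  have D: "((\<lambda>x. h (g x)) has_derivative (\<lambda>v. deriv_along (deriv_along v g x) h (g x))) (at x)" for x
    by (rule has_derivative_compose) (use Suc.prems in \<open>auto intro: differentiable_has_derivative_along\<close>)
  have "deriv_along v (\<lambda>x. h (g x)) = (\<lambda>x. deriv_along v g x *\<^sub>R deriv_along 1 h (g x))" for v
  proof
    fix x
    have "deriv_along v (\<lambda>x. h (g x)) x = deriv_along (deriv_along v g x) h (g x)"
      by (rule deriv_along_eq[OF D])
    also have "\<dots> = deriv_along v g x *\<^sub>R deriv_along 1 h (g x)"
      using deriv_along_sum_Basis[of h "g x" "deriv_along v g x"] Suc.prems by simp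
    finally show "deriv_along v (\<lambda>x. h (g x)) x = deriv_along v g x *\<^sub>R deriv_along 1 h (g x)" .
  qed
  moreover have "n_smooth n g" using Suc.prems n_smooth_Suc_imp by blast
  ultimately show ?case
    using differentiableI[OF D] Suc by (auto intro!: n_smooth_bilinear[OF bounded_bilinear_scaleR])
qed

lemma n_smooth_linear_compose:
  assumes L: "bounded_linear L"
  shows "n_smooth n f \<Longrightarrow> n_smooth n (\<lambda>x. L (f x))"
proof (induction n arbitrary: f)
  case 0
  then show ?case
    unfolding n_smooth.simps differentiable_def by (blast dest: bounded_linear.has_derivative[OF L])
next
  case (Suc n)
  have D: "((\<lambda>x. L (f x)) has_derivative (\<lambda>v. L (deriv_along v f x))) (at x)" for x
    by (rule bounded_linear.has_derivative[OF L])
      (use Suc.prems in \<open>auto intro: differentiable_has_derivative_along\<close>)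
  have "deriv_along v (\<lambda>x. L (f x)) = (\<lambda>x. L (deriv_along v f x))" for v
    by (rule ext) (rule deriv_along_eq[OF D])
  then show ?case using differentiableI[OF D] Suc by auto
qed

lemma smooth_const: "smooth (\<lambda>x. c)"
  by (simp add: smooth_iff_n_smooth n_smooth_const)

lemma smooth_add: "smooth f \<Longrightarrow> smooth g \<Longrightarrow> smooth (\<lambda>x. f x + g x)"
  by (simp add: smooth_iff_n_smooth n_smooth_add)

lemma smooth_scaleR: "smooth f \<Longrightarrow> smooth g \<Longrightarrow> smooth (\<lambda>x. f x *\<^sub>R g x)"
  by (simp add: smooth_iff_n_smooth n_smooth_bilinear[OF bounded_bilinear_scaleR])

lemma smooth_mult: "smooth f \<Longrightarrow> smooth g \<Longrightarrow> smooth (\<lambda>x. f x * (g x :: real))"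
  by (simp add: smooth_iff_n_smooth n_smooth_bilinear[OF bounded_bilinear_mult])

lemma smooth_compose_affine: "bounded_linear L \<Longrightarrow> smooth f \<Longrightarrow> smooth (\<lambda>x. f (L x + c))"
  by (simp add: smooth_iff_n_smooth n_smooth_compose_affine)

lemma smooth_compose_linear: "bounded_linear L \<Longrightarrow> smooth f \<Longrightarrow> smooth (\<lambda>x. f (L x))"
  using smooth_compose_affine[of L f 0] by simp

lemma smooth_compose_real: "smooth h \<Longrightarrow> smooth g \<Longrightarrow> smooth (\<lambda>x. h (g x :: real))"
  by (simp add: smooth_iff_n_smooth n_smooth_compose_real)

lemma smooth_linear_compose: "bounded_linear L \<Longrightarrow> smooth f \<Longrightarrow> smooth (\<lambda>x. L (f x))"
  by (simp add: smooth_iff_n_smooth n_smooth_linear_compose)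

lemma smooth_bounded_linear: "bounded_linear L \<Longrightarrow> smooth L"
proof -
  assume L: "bounded_linear L"
  have D: "(L has_derivative L) (at x)" for x
    using L by (rule bounded_linear_imp_has_derivative)
  then have "deriv_along v L = (\<lambda>x. L v)" for v
    by (intro ext) (rule deriv_along_eq)
  then have "n_smooth n L" for n
    using D by (cases n) (auto simp: differentiable_def n_smooth_const)
  then show ?thesis by (simp add: smooth_iff_n_smooth)
qed

lemma deriv_along_add:
  assumes "f differentiable at x" "g differentiable at x"
  shows "deriv_along v (\<lambda>x. f x + g x) x = deriv_along v f x + deriv_along v g x"
  by (rule deriv_along_eq[OF has_derivative_add]) (auto intro: differentiable_has_derivative_along assms)

lemma iter_deriv_add:
  assumes "smooth f" "smooth g" "vs \<in> lists Basis"
  shows "iter_deriv vs (\<lambda>x. f x + g x) = (\<lambda>x. iter_deriv vs f x + iter_deriv vs g x)"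
  using assms(3)
proof (induction vs)
  case (Cons v vs)
  then show ?case
    using assms(1,2)
    by (auto simp: iter_deriv_Cons intro!: ext deriv_along_add smooth_differentiable smooth_iter_deriv)
qed simp

section \<open>Smooth cutoffs\<close>

text \<open>Differentiating exp(-1/x) produces powers of 1/x. Carrying the power k makes the span of
  the family closed under differentiation.\<close>

definition flat_exp :: "nat \<Rightarrow> real \<Rightarrow> real" where
  "flat_exp k x = (if x \<le> 0 then 0 else inverse x ^ k * exp (- inverse x))"

text \<open>From the right, substituting y = 1/x turns the claim into y^k / e^y tending to 0 at
  infinity.\<close>

lemma flat_exp_tendsto_0: "(flat_exp k \<longlongrightarrow> 0) (at 0)"
proof -
  have "((\<lambda>x. inverse x ^ k / exp (inverse x)) \<longlongrightarrow> 0) (at_right (0::real))"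
    by (rule filterlim_compose[OF tendsto_power_div_exp_0 filterlim_inverse_at_top_right])
  moreover have "eventually (\<lambda>x. inverse x ^ k / exp (inverse x) = flat_exp k x) (at_right (0::real))"
    using eventually_at_right_less[of 0]
    by eventually_elim (simp add: flat_exp_def exp_minus field_simps)
  ultimately have "(flat_exp k \<longlongrightarrow> 0) (at_right 0)"
    by (rule Lim_transform_eventually)
  moreover have "(flat_exp k \<longlongrightarrow> 0) (at_left 0)"
  proof (rule Lim_transform_eventually[OF tendsto_const])
    show "eventually (\<lambda>x. 0 = flat_exp k x) (at_left (0::real))"
      by (auto simp: flat_exp_def eventually_at_left[of "-1"] intro!: exI[of _ "-1"])
  qed
  ultimately show ?thesis by (simp add: filterlim_split_at)
qed

lemma flat_exp_has_real_derivative: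
  "(flat_exp k has_real_derivative (flat_exp (k+2) x - k * flat_exp (k+1) x)) (at x)"
proof -
  consider "x < 0" | "x = 0" | "x > 0" by linarith
  then show ?thesis
  proof cases
    case 1
    have "((\<lambda>x. 0) has_real_derivative 0) (at x)" by simp
    then have "(flat_exp k has_real_derivative 0) (at x)"
      by (rule has_field_derivative_transform_within_open[of _ _ _ "{..<0}"]) (use 1 in \<open>auto simp: flat_exp_def\<close>)
    then show ?thesis using 1 by (simp add: flat_exp_def)
  next
    case 2
    \<comment> \<open>The difference quotient at 0 is exactly the next member of the family, so its
      limit at 0 is already known.\<close>
    have "(\<lambda>h. (flat_exp k (0 + h) - flat_exp k 0) / h) = flat_exp (k+1)"
      by (auto simp: flat_exp_def divide_inverse fun_eq_iff)
    then have "(flat_exp k has_real_derivative 0) (at 0)"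
      using flat_exp_tendsto_0[of "k+1"] by (simp add: DERIV_def)
    then show ?thesis using 2 by (simp add: flat_exp_def)
  next
    case 3
    \<comment> \<open>The truncated exponent \<open>k - 1\<close> at k = 0 is harmless because the
      factor k vanishes there.\<close>
    have "real k * inverse x ^ (k - 1) * inverse (x * x) = real k * inverse x ^ (k + 1)"
      by (cases k) auto
    then have "((\<lambda>x. inverse x ^ k * exp (- inverse x)) has_real_derivative
       (inverse x ^ (k+2) * exp (- inverse x) - k * (inverse x ^ (k+1) * exp (- inverse x)))) (at x)"
      using 3 by (auto intro!: derivative_eq_intros simp: algebra_simps)
    then have "(flat_exp k has_real_derivative (inverse x ^ (k+2) * exp (- inverse x) - k * (inverse x ^ (k+1) * exp (- inverse x)))) (at x)"
      by (rule has_field_derivative_transform_within_open[of _ _ _ "{0<..}"]) (use 3 in \<open>auto simp: flat_exp_def\<close>)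
    then show ?thesis using 3 by (simp add: flat_exp_def)
  qed
qed

lemma n_smooth_flat_exp: "n_smooth n (flat_exp k)"
proof (induction n arbitrary: k)
  case 0
  then show ?case
    using flat_exp_has_real_derivative by (auto simp: real_differentiable_def)
next
  case (Suc n)
  have eq: "deriv_along 1 (flat_exp k) = (\<lambda>x. flat_exp (k+2) x + (- real k) * flat_exp (k+1) x)"
    using deriv_along_eq[OF flat_exp_has_real_derivative[unfolded has_field_derivative_def], of 1 k]
    by (auto simp: fun_eq_iff)
  have "n_smooth n (deriv_along 1 (flat_exp k))"
    unfolding eq by (intro n_smooth_add n_smooth_bilinear[OF bounded_bilinear_mult] n_smooth_const Suc)
  then show ?case
    using flat_exp_has_real_derivative by (auto simp: real_differentiable_def)
qed

text \<open>With E(x) = exp(-1/x) for positive x and 0 otherwise, e E(2 - y) is at least 1 for y at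
  most 1 and is 0 for y at least 2. The outer E thus receives an argument that is at most 0 on the
  left and 1 on the right, and the factor e normalises E(1). Nesting instead of forming a quotient
  leaves only compositions to check, and monotonicity is immediate.\<close>

definition smooth_step :: "real \<Rightarrow> real" where
  "smooth_step y = exp 1 * flat_exp 0 (1 - exp 1 * flat_exp 0 (2 - y))"

lemma smooth_smooth_step: "smooth smooth_step"
proof -
  have 1: "smooth (flat_exp 0)" by (simp add: smooth_iff_n_smooth n_smooth_flat_exp)
  have 2: "smooth (\<lambda>y. flat_exp 0 (2 - y))"
    using smooth_compose_affine[of uminus "flat_exp 0" 2] 1 bounded_linear_minus[OF bounded_linear_ident] by simp
  have "smooth (\<lambda>y. 1 + (- exp 1) * flat_exp 0 (2 - y))"
    by (intro smooth_add smooth_mult smooth_const 2)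
  then have "smooth (\<lambda>y. flat_exp 0 (1 - exp 1 * flat_exp 0 (2 - y)))"
    using smooth_compose_real[OF 1] by simp
  then show ?thesis
    by (simp add: smooth_step_def[abs_def] smooth_mult smooth_const)
qed

lemma flat_exp_mono: "x \<le> y \<Longrightarrow> flat_exp 0 x \<le> flat_exp 0 y"
  by (auto simp: flat_exp_def le_imp_inverse_le)

lemma smooth_step_mono: "mono smooth_step"
  unfolding smooth_step_def by (intro monoI mult_left_mono flat_exp_mono diff_left_mono) auto

lemma smooth_step_eq_1: "2 \<le> y \<Longrightarrow> smooth_step y = 1"
  by (simp add: smooth_step_def flat_exp_def flip: exp_add)

lemma smooth_step_eq_0: "y \<le> 1 \<Longrightarrow> smooth_step y = 0"
proof -
  assume "y \<le> 1"
  then have "flat_exp 0 1 \<le> flat_exp 0 (2 - y)" by (intro flat_exp_mono) simp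
  then have "exp 1 * flat_exp 0 1 \<le> exp 1 * flat_exp 0 (2 - y)" by simp
  moreover have "exp 1 * flat_exp 0 1 = 1" by (simp add: flat_exp_def flip: exp_add)
  ultimately have "1 - exp 1 * flat_exp 0 (2 - y) \<le> 0" by simp
  then show ?thesis by (simp add: smooth_step_def flat_exp_def[of 0 "1 - _"])
qed

lemma smooth_step_bounds: "0 \<le> smooth_step y" "smooth_step y \<le> 1"
proof -
  show "0 \<le> smooth_step y" by (simp add: smooth_step_def flat_exp_def)
  show "smooth_step y \<le> 1"
    using monoD[OF smooth_step_mono, of y "max y 2"] smooth_step_eq_1[of "max y 2"] by simp
qed

text \<open>\<open>has_boundary_pairing\<close> quantifies over all cutoff sequences; a concrete one
  is what allows a conclusion about its value.\<close>

lemma time_cutoffs_exist: "\<exists>\<eta>. time_cutoffs t \<eta>"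
proof -
  \<comment> \<open>The argument of the step is n (s - t) + 1: it is at most 1 for s at most t, and
    exceeds 2 as soon as n (s - t) > 1.\<close>
  define \<eta> where "\<eta> n s = 1 + (-1) * smooth_step (real n * s + (1 - real n * t))" for n s
  have "smooth (\<eta> n)" for n
    unfolding \<eta>_def
    by (intro smooth_add smooth_mult smooth_const smooth_compose_affine[OF bounded_linear_mult_right] smooth_smooth_step)
  moreover have "antimono (\<eta> n)" for n
    unfolding \<eta>_def by (auto intro!: antimonoI monoD[OF smooth_step_mono] mult_left_mono)
  moreover have "\<eta> n s = 1" if "s \<le> t" for n s
    using that mult_left_mono[of s t "real n"] by (simp add: \<eta>_def smooth_step_eq_0)
  moreover have "(\<lambda>n. \<eta> n s) \<longlonglongrightarrow> 0" if "s > t" for s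
  proof (rule tendsto_eventually)
    obtain N where N: "1 / (s - t) < real N" using reals_Archimedean2 by blast
    show "eventually (\<lambda>n. \<eta> n s = 0) sequentially"
    proof (rule eventually_sequentiallyI[of N])
      fix n assume "N \<le> n"
      then have "1 / (s - t) < real n" using N by linarith
      then have "1 < real n * (s - t)" using that by (simp add: field_simps)
      then show "\<eta> n s = 0" by (simp add: \<eta>_def smooth_step_eq_1 algebra_simps)
    qed
  qed
  ultimately show ?thesis unfolding time_cutoffs_def by blast
qed


section \<open>Reflection in the boundary\<close>

definition mirror :: "real^3 \<Rightarrow> real^3" where
  "mirror x = vector [x $ 1, x $ 2, - x $ 3]"

lemma mirror_nth [simp]: "mirror x $ 1 = x $ 1" "mirror x $ 2 = x $ 2" "mirror x $ 3 = - x $ 3"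
  by (simp_all add: mirror_def vector_3)

lemma reflect_field_eq: "reflect_field f x = mirror (f (mirror x))"
  by (simp add: reflect_field_def mirror_def Let_def)

lemma mirror_mirror [simp]: "mirror (mirror x) = x"
  by (simp add: vec_eq_iff forall_3)

lemma mirror_0 [simp]: "mirror 0 = 0"
  by (simp add: vec_eq_iff forall_3)

lemma bounded_linear_mirror: "bounded_linear mirror"
  unfolding linear_conv_bounded_linear[symmetric]
  by (rule linearI) (simp_all add: vec_eq_iff forall_3)

lemma mirror_add: "mirror (x + y) = mirror x + mirror y"
  by (simp add: vec_eq_iff forall_3)

lemma mirror_diff: "mirror (x - y) = mirror x - mirror y"
  by (simp add: vec_eq_iff forall_3)

lemma inner_mirror_mirror [simp]: "mirror x \<bullet> mirror y = x \<bullet> y"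
  by (simp add: inner_vec_def sum_3)

lemma inner_mirror_left: "mirror x \<bullet> y = x \<bullet> mirror y"
  by (simp add: inner_vec_def sum_3)

lemma norm_mirror [simp]: "norm (mirror x) = norm x"
  by (simp add: norm_eq_sqrt_inner)

lemma mirror_axis: "mirror (axis i 1) = (if i = 3 then - axis i 1 else axis i 1)"
proof -
  have "i = 1 \<or> i = 2 \<or> i = 3" by (rule exhaust_3)
  then show ?thesis by (elim disjE) (simp_all add: vec_eq_iff forall_3 axis_def)
qed

text \<open>This coordinatewise scaling is the form in which the affine change of variables for
  Lebesgue measure is available; the Jacobian is the product of the absolute values of the signs,
  hence 1.\<close>

lemma mirror_eq_affine:
  "mirror = (\<lambda>x. 0 + (\<Sum>j\<in>Basis. ((if j = axis 3 1 then -1 else 1) * (x \<bullet> j)) *\<^sub>R j))"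
proof
  fix x :: "real^3"
  show "mirror x = 0 + (\<Sum>j\<in>Basis. ((if j = axis 3 1 then -1 else 1) * (x \<bullet> j)) *\<^sub>R j)"
  proof (rule euclidean_eqI)
    fix b :: "real^3" assume b: "b \<in> Basis"
    then obtain i where i: "b = axis i 1" by (auto simp: Basis_vec_def)
    have "mirror x \<bullet> b = x \<bullet> mirror b" by (rule inner_mirror_left)
    also have "\<dots> = (if b = axis 3 1 then -1 else 1) * (x \<bullet> b)"
      by (auto simp: i mirror_axis axis_eq_axis)
    also have "\<dots> = (0 + (\<Sum>j\<in>Basis. ((if j = axis 3 1 then -1 else 1) * (x \<bullet> j)) *\<^sub>R j)) \<bullet> b"
      using b by (simp add: inner_sum_left_Basis)
    finally show "mirror x \<bullet> b = (0 + (\<Sum>j\<in>Basis. ((if j = axis 3 1 then -1 else 1) * (x \<bullet> j)) *\<^sub>R j)) \<bullet> b" .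
  qed
qed

lemma mirror_measurable [measurable]: "mirror \<in> lebesgue \<rightarrow>\<^sub>M lebesgue"
  unfolding mirror_eq_affine by (rule lebesgue_affine_measurable) auto

lemma lebesgue_distr_mirror: "distr lebesgue lebesgue mirror = lebesgue"
proof -
  have "(\<Prod>j\<in>Basis. \<bar>if j = (axis 3 1 :: real^3) then -1 else 1 :: real\<bar>) = 1"
    by (rule prod.neutral) auto
  then show ?thesis
    using lebesgue_affine_euclidean[of "\<lambda>j. if j = (axis 3 1 :: real^3) then -1 else 1" 0]
    by (simp add: mirror_eq_affine[symmetric] density_1 del: add_0)
qed

lemma has_bochner_integral_mirror:
  fixes f :: "real^3 \<Rightarrow> 'b::{banach, second_countable_topology}"
  assumes "has_bochner_integral lebesgue f i"
  shows "has_bochner_integral lebesgue (\<lambda>x. f (mirror x)) i"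
proof -
  have "f \<in> borel_measurable lebesgue" using assms by (auto simp: has_bochner_integral.simps)
  then have "(\<lambda>x. f (mirror x)) \<in> borel_measurable lebesgue"
    by (rule measurable_compose[OF mirror_measurable])
  from has_bochner_integral_distr[OF this mirror_measurable, of i] assms show ?thesis
    by (simp add: lebesgue_distr_mirror)
qed

section \<open>Square-integrable fields on the half space and on the whole space\<close>

lemma cell_borel: "cell \<in> sets borel"
proof -
  have "cell = {x. 0 \<le> x \<bullet> axis 1 1} \<inter> {x. x \<bullet> axis 1 1 < 2 * pi} \<inter> {x. 0 \<le> x \<bullet> axis 2 1} \<inter> {x. x \<bullet> axis 2 1 < 2 * pi}"
    by (auto simp: cell_def inner_axis)
  also have "\<dots> \<in> sets borel" by measurable
  finally show ?thesis .
qed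

lemma D_plus_borel: "D_plus \<in> sets borel"
proof -
  have "D_plus = {x. 0 \<le> x \<bullet> axis 3 1}" by (auto simp: D_plus_def inner_axis)
  also have "\<dots> \<in> sets borel" by measurable
  finally show ?thesis .
qed

lemma D_plus_cell_sets: "D_plus \<inter> cell \<in> sets lebesgue"
  using cell_borel D_plus_borel by auto

lemma D_full_cell_sets: "D_full \<inter> cell \<in> sets lebesgue"
  using cell_borel by (auto simp: D_full_def)

text \<open>\<open>D_plus\<close> and \<open>D_minus\<close> share this plane, and
  \<open>extend_field\<close> has a separate value on it. Being null, it can be ignored in every
  integral.\<close>

lemma AE_off_boundary: "AE x in (lebesgue :: (real^3) measure). x $ 3 \<noteq> 0"
proof -
  have "negligible {x::real^3. axis 3 1 \<bullet> x = 0}"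
    by (rule negligible_hyperplane) (simp add: axis_eq_0_iff)
  then show ?thesis
    by (auto simp: negligible_iff_null_sets inner_axis' intro!: AE_I')
qed

lemma mirror_mem_cell [simp]: "mirror x \<in> cell \<longleftrightarrow> x \<in> cell"
  by (simp add: cell_def)

lemma extend_field_upper: "0 < x $ 3 \<Longrightarrow> extend_field f x = f x"
  by (simp add: extend_field_def zero_extend_def D_plus_def D_minus_def)

lemma extend_field_lower: "x $ 3 < 0 \<Longrightarrow> extend_field f x = mirror (f (mirror x))"
  by (simp add: extend_field_def zero_extend_def D_plus_def D_minus_def reflect_field_eq)

lemma has_bochner_integral_vol_iff:
  fixes f :: "real^3 \<Rightarrow> 'b::{banach, second_countable_topology}"
  assumes "\<Omega> \<inter> cell \<in> sets lebesgue"
  shows "has_bochner_integral (vol \<Omega>) f i \<longleftrightarrow> has_bochner_integral lebesgue (\<lambda>x. indicator (\<Omega> \<inter> cell) x *\<^sub>R f x) i"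
  using assms by (simp add: vol_def has_bochner_integral_restrict_space)

text \<open>An integral over the whole cell splits at the boundary, and the lower half is carried to
  the upper one by z -> -z. Existence and value travel together in
  \<open>has_bochner_integral\<close>, so this one lemma yields both integrability and the formula.
  Nothing is asked of F on the plane itself.\<close>

lemma has_bochner_integral_full:
  fixes F G G' :: "real^3 \<Rightarrow> real"
  assumes G: "has_bochner_integral (vol D_plus) G a" and G': "has_bochner_integral (vol D_plus) G' b"
    and F: "\<And>x. 0 < x $ 3 \<Longrightarrow> F x = G x" "\<And>x. 0 < x $ 3 \<Longrightarrow> F (mirror x) = G' x"
  shows "has_bochner_integral (vol D_full) F (a + b)"
proof -
  \<comment> \<open>On the plane x_3 = 0 both indicators can be 1, so H agrees with F on the cell
    only almost everywhere.\<close>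
  define H where "H x = indicator (D_plus \<inter> cell) x *\<^sub>R G x + indicator (D_plus \<inter> cell) (mirror x) *\<^sub>R G' (mirror x)" for x
  have H: "has_bochner_integral lebesgue H (a + b)"
    unfolding H_def
    by (intro has_bochner_integral_add has_bochner_integral_mirror[where f = "\<lambda>x. indicator (D_plus \<inter> cell) x *\<^sub>R G' x"])
      (use G G' in \<open>auto simp: has_bochner_integral_vol_iff D_plus_cell_sets\<close>)
  have "H x = indicator (D_full \<inter> cell) x *\<^sub>R F x" if "x $ 3 \<noteq> 0" for x
    using that F(1)[of x] F(2)[of "mirror x"]
    by (cases "0 < x $ 3") (auto simp: H_def D_plus_def D_full_def split: split_indicator)
  then have ae: "AE x in lebesgue. H x = indicator (D_full \<inter> cell) x *\<^sub>R F x"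
    using AE_off_boundary by (auto elim: eventually_mono)
  have "H \<in> borel_measurable lebesgue" using H by (auto simp: has_bochner_integral.simps)
  \<comment> \<open>Lebesgue measure is complete, so measurability passes to an almost everywhere
    equal function.\<close>
  moreover from this ae have "(\<lambda>x. indicator (D_full \<inter> cell) x *\<^sub>R F x) \<in> borel_measurable lebesgue"
    by (rule borel_measurable_AE)
  ultimately show ?thesis
    unfolding has_bochner_integral_vol_iff[OF D_full_cell_sets]
    using H ae has_bochner_integral_cong_AE[of H lebesgue "\<lambda>x. indicator (D_full \<inter> cell) x *\<^sub>R F x"] by blast
qed

lemma vol_D_plus_eq: "vol D_plus = restrict_space (vol D_full) D_plus"
proof -
  have "restrict_space (lebesgue_on cell) D_plus = lebesgue_on (cell \<inter> D_plus)"
    using cell_borel D_plus_borel by (intro restrict_restrict_space) auto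
  then show ?thesis by (simp add: vol_def D_full_def Int_commute)
qed

lemma L2_D_full_imp_D_plus: "f \<in> L2 D_full \<Longrightarrow> f \<in> L2 D_plus"
proof -
  assume f: "f \<in> L2 D_full"
  have "f \<in> borel_measurable (vol D_plus)"
    using f by (auto simp: L2_def vol_D_plus_eq measurable_restrict_space1)
  moreover have "integrable (vol D_plus) (\<lambda>x. (norm (f x))\<^sup>2)"
  proof -
    have "integrable lebesgue (\<lambda>x. indicator (D_full \<inter> cell) x *\<^sub>R (norm (f x))\<^sup>2)"
      using f D_full_cell_sets by (simp add: L2_def vol_def integrable_restrict_space)
    then have "integrable lebesgue (\<lambda>x. indicator (D_plus \<inter> cell) x *\<^sub>R (indicator (D_full \<inter> cell) x *\<^sub>R (norm (f x))\<^sup>2))"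
      by (rule integrable_mult_indicator[OF D_plus_cell_sets])
    also have "(\<lambda>x. indicator (D_plus \<inter> cell) x *\<^sub>R (indicator (D_full \<inter> cell) x *\<^sub>R (norm (f x))\<^sup>2)) =
        (\<lambda>x. indicator (D_plus \<inter> cell) x *\<^sub>R (norm (f x))\<^sup>2)"
      by (auto simp: D_full_def indicator_def)
    finally show ?thesis
      using D_plus_cell_sets by (simp add: vol_def integrable_restrict_space)
  qed
  ultimately show ?thesis using f by (auto simp: L2_def periodic_on_def D_full_def)
qed

lemma borel_measurable_vol_iff:
  fixes f :: "real^3 \<Rightarrow> 'b::euclidean_space"
  assumes "\<Omega> \<inter> cell \<in> sets lebesgue"
  shows "f \<in> borel_measurable (vol \<Omega>) \<longleftrightarrow> (\<lambda>x. if x \<in> \<Omega> \<inter> cell then f x else 0) \<in> borel_measurable lebesgue"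
  unfolding vol_def using assms by (rule borel_measurable_if[symmetric])

lemma borel_measurable_mirror [measurable]: "mirror \<in> borel_measurable borel"
  by (rule borel_measurable_continuous_onI) (rule linear_continuous_on[OF bounded_linear_mirror])

lemma periods_nth_3: "v \<in> periods \<Longrightarrow> v $ 3 = 0"
  by (auto simp: periods_def axis_def)

lemma mirror_periods: "v \<in> periods \<Longrightarrow> mirror v = v"
  using periods_nth_3[of v] by (simp add: vec_eq_iff forall_3)

lemma L2_reflect_field: "f \<in> L2 D_full \<Longrightarrow> reflect_field f \<in> L2 D_full"
proof -
  assume f: "f \<in> L2 D_full"
  have [measurable]: "(\<lambda>x. if x \<in> D_full \<inter> cell then f x else 0) \<in> borel_measurable lebesgue"
    using f by (simp add: L2_def borel_measurable_vol_iff D_full_cell_sets)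
  have "(\<lambda>x. mirror ((\<lambda>x. if x \<in> D_full \<inter> cell then f x else 0) (mirror x))) \<in> borel_measurable lebesgue"
    by (intro measurable_compose[OF _ borel_measurable_mirror] measurable_compose[OF mirror_measurable]) measurable
  also have "(\<lambda>x. mirror ((\<lambda>x. if x \<in> D_full \<inter> cell then f x else 0) (mirror x))) =
     (\<lambda>x. if x \<in> D_full \<inter> cell then reflect_field f x else 0)"
    by (auto simp: D_full_def reflect_field_eq)
  finally have m: "reflect_field f \<in> borel_measurable (vol D_full)"
    by (simp add: borel_measurable_vol_iff D_full_cell_sets)
  have "integrable (vol D_full) (\<lambda>x. (norm (f x))\<^sup>2)" using f by (simp add: L2_def)
  then have "has_bochner_integral lebesgue (\<lambda>x. indicator (D_full \<inter> cell) x *\<^sub>R (norm (f x))\<^sup>2) (integral\<^sup>L (vol D_full) (\<lambda>x. (norm (f x))\<^sup>2))"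
    unfolding has_bochner_integral_vol_iff[OF D_full_cell_sets, symmetric] by (rule has_bochner_integral_integrable)
  from has_bochner_integral_mirror[OF this]
  have "has_bochner_integral lebesgue (\<lambda>x. indicator (D_full \<inter> cell) x *\<^sub>R (norm (reflect_field f x))\<^sup>2) (integral\<^sup>L (vol D_full) (\<lambda>x. (norm (f x))\<^sup>2))"
    by (simp add: reflect_field_eq D_full_def indicator_def)
  then have "integrable (vol D_full) (\<lambda>x. (norm (reflect_field f x))\<^sup>2)"
    using has_bochner_integral_vol_iff[OF D_full_cell_sets] integrable.intros by blast
  moreover have "periodic_on UNIV periods (reflect_field f)"
    using f by (auto simp: L2_def periodic_on_def reflect_field_eq mirror_add mirror_periods D_full_def)
  ultimately show ?thesis using m by (simp add: L2_def D_full_def)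
qed

lemma L2_extend_field:
  assumes f: "f \<in> L2 D_plus"
  shows "extend_field f \<in> L2 D_full"
proof -
  define F where "F x = (if x \<in> D_plus \<inter> cell then f x else 0)" for x
  have [measurable]: "F \<in> borel_measurable lebesgue"
    using f by (simp add: F_def[abs_def] L2_def borel_measurable_vol_iff D_plus_cell_sets del: Int_iff)
  have 1: "(\<lambda>x. F x + mirror (F (mirror x))) \<in> borel_measurable lebesgue"
    by (intro borel_measurable_add measurable_compose[OF _ borel_measurable_mirror] measurable_compose[OF mirror_measurable]) measurable
  have "F x + mirror (F (mirror x)) = (if x \<in> D_full \<inter> cell then extend_field f x else 0)" if "x $ 3 \<noteq> 0" for x
    using that by (cases "0 < x $ 3") (auto simp: F_def D_plus_def D_full_def extend_field_upper extend_field_lower)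
  then have ae: "AE x in lebesgue. F x + mirror (F (mirror x)) = (if x \<in> D_full \<inter> cell then extend_field f x else 0)"
    using AE_off_boundary by (auto elim!: eventually_mono)
  have m: "extend_field f \<in> borel_measurable (vol D_full)"
    using borel_measurable_AE[OF 1 ae] by (simp add: borel_measurable_vol_iff D_full_cell_sets del: Int_iff)
  have fi: "has_bochner_integral (vol D_plus) (\<lambda>x. (norm (f x))\<^sup>2) (integral\<^sup>L (vol D_plus) (\<lambda>x. (norm (f x))\<^sup>2))"
    using f by (simp add: L2_def has_bochner_integral_integrable)
  have "has_bochner_integral (vol D_full) (\<lambda>x. (norm (extend_field f x))\<^sup>2)
     (integral\<^sup>L (vol D_plus) (\<lambda>x. (norm (f x))\<^sup>2) + integral\<^sup>L (vol D_plus) (\<lambda>x. (norm (f x))\<^sup>2))"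
    by (rule has_bochner_integral_full[OF fi fi]) (simp_all add: extend_field_upper extend_field_lower)
  then have "integrable (vol D_full) (\<lambda>x. (norm (extend_field f x))\<^sup>2)"
    by (rule integrable.intros)
  moreover have "periodic_on D_full periods (extend_field f)"
    unfolding periodic_on_def D_full_def
  proof (intro ballI)
    fix v x assume v: "v \<in> periods"
    have p: "f (y + v) = f y" if "0 \<le> y $ 3" for y
      using f v that by (auto simp: L2_def periodic_on_def D_plus_def)
    have v3: "(x + v) $ 3 = x $ 3" using periods_nth_3[OF v] by simp
    \<comment> \<open>Periodicity in \<open>L2\<close> is demanded at every point, so the boundary
      plane gets its own case here.\<close>
    consider "x $ 3 < 0" | "x $ 3 = 0" | "0 < x $ 3" by linarith
    then show "extend_field f (x + v) = extend_field f x"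
    proof cases
      case 1 then show ?thesis
        using v3 p[of "mirror x"] by (simp add: extend_field_lower mirror_add mirror_periods[OF v])
    next
      case 2 then show ?thesis using v3 p[of x] by (simp add: extend_field_def)
    next
      case 3 then show ?thesis using v3 p[of x] by (simp add: extend_field_upper)
    qed
  qed
  ultimately show ?thesis using m by (simp add: L2_def)
qed

lemma integrable_L2_inner:
  assumes f: "f \<in> L2 \<Omega>" and g: "g \<in> L2 \<Omega>"
  shows "integrable (vol \<Omega>) (\<lambda>x. f x \<bullet> g x)"
proof (rule Bochner_Integration.integrable_bound)
  show "integrable (vol \<Omega>) (\<lambda>x. (norm (f x))\<^sup>2 + (norm (g x))\<^sup>2)"
    using f g by (simp add: L2_def)
  show "(\<lambda>x. f x \<bullet> g x) \<in> borel_measurable (vol \<Omega>)"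
    using f g by (simp add: L2_def borel_measurable_inner)
  have "\<bar>f x \<bullet> g x\<bar> \<le> (norm (f x))\<^sup>2 + (norm (g x))\<^sup>2" for x
  proof -
    have "\<bar>f x \<bullet> g x\<bar> \<le> norm (f x) * norm (g x)" by (rule Cauchy_Schwarz_ineq2)
    also have "\<dots> \<le> (norm (f x))\<^sup>2 + (norm (g x))\<^sup>2"
      using sum_squares_bound[of "norm (f x)" "norm (g x)"] mult_nonneg_nonneg[OF norm_ge_zero[of "f x"] norm_ge_zero[of "g x"]]
      by linarith
    finally show ?thesis .
  qed
  then show "AE x in vol \<Omega>. norm (f x \<bullet> g x) \<le> norm ((norm (f x))\<^sup>2 + (norm (g x))\<^sup>2)" by simp
qed

lemma norm_add_square_le: "(norm (a + b))\<^sup>2 \<le> 2 * (norm a)\<^sup>2 + 2 * (norm b)\<^sup>2" for a b :: "'a::real_normed_vector"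
proof -
  have "(norm (a + b))\<^sup>2 \<le> (norm a + norm b)\<^sup>2" by (intro power_mono norm_triangle_ineq) simp
  also have "\<dots> \<le> 2 * (norm a)\<^sup>2 + 2 * (norm b)\<^sup>2"
    using sum_squares_bound[of "norm a" "norm b"] by (simp add: power2_sum)
  finally show ?thesis .
qed

lemma L2_add:
  assumes f: "f \<in> L2 \<Omega>" and g: "g \<in> L2 \<Omega>"
  shows "(\<lambda>x. f x + g x) \<in> L2 \<Omega>"
proof -
  have m: "(\<lambda>x. f x + g x) \<in> borel_measurable (vol \<Omega>)"
    using f g by (auto simp: L2_def intro: borel_measurable_add)
  have "integrable (vol \<Omega>) (\<lambda>x. (norm (f x + g x))\<^sup>2)"
  proof (rule Bochner_Integration.integrable_bound)
    show "integrable (vol \<Omega>) (\<lambda>x. 2 * (norm (f x))\<^sup>2 + 2 * (norm (g x))\<^sup>2)"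
      using f g by (simp add: L2_def)
    show "(\<lambda>x. (norm (f x + g x))\<^sup>2) \<in> borel_measurable (vol \<Omega>)" using m by measurable
  qed (auto simp: norm_add_square_le)
  then show ?thesis using f g m by (auto simp: L2_def periodic_on_def)
qed

text \<open>The reflection is a symmetric linear map and can be moved from the field onto g. For
  fixed g the right-hand side consists of two pairings with fixed fields, which is how weak
  continuity passes to the extension.\<close>

lemma L2_inner_extend_field:
  assumes f: "f \<in> L2 D_plus" and g: "g \<in> L2 D_full"
  shows "L2_inner D_full (extend_field f) g = L2_inner D_plus f g + L2_inner D_plus f (reflect_field g)"
proof -
  have "has_bochner_integral (vol D_full) (\<lambda>x. extend_field f x \<bullet> g x)
    (integral\<^sup>L (vol D_plus) (\<lambda>x. f x \<bullet> g x) + integral\<^sup>L (vol D_plus) (\<lambda>x. f x \<bullet> reflect_field g x))"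
  proof (rule has_bochner_integral_full)
    show "has_bochner_integral (vol D_plus) (\<lambda>x. f x \<bullet> g x) (integral\<^sup>L (vol D_plus) (\<lambda>x. f x \<bullet> g x))"
      by (intro has_bochner_integral_integrable integrable_L2_inner[OF f L2_D_full_imp_D_plus[OF g]])
    show "has_bochner_integral (vol D_plus) (\<lambda>x. f x \<bullet> reflect_field g x) (integral\<^sup>L (vol D_plus) (\<lambda>x. f x \<bullet> reflect_field g x))"
      by (intro has_bochner_integral_integrable integrable_L2_inner[OF f L2_D_full_imp_D_plus[OF L2_reflect_field[OF g]]])
  qed (simp_all add: extend_field_upper extend_field_lower reflect_field_eq inner_mirror_left)
  then show ?thesis by (simp add: L2_inner_def has_bochner_integral_iff)
qed

lemma L2_inner_add_right:
  assumes "f \<in> L2 \<Omega>" "g \<in> L2 \<Omega>" "h \<in> L2 \<Omega>"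
  shows "L2_inner \<Omega> f (\<lambda>x. g x + h x) = L2_inner \<Omega> f g + L2_inner \<Omega> f h"
  using assms by (simp add: L2_inner_def inner_add_right integrable_L2_inner)


section \<open>Rapidly decreasing fields\<close>

lemma deriv_along_reflect_field:
  assumes "f differentiable at (mirror x)"
  shows "(reflect_field f has_derivative (\<lambda>v. mirror (deriv_along (mirror v) f (mirror x)))) (at x)"
proof -
  have "((\<lambda>x. f (mirror x)) has_derivative (\<lambda>v. deriv_along (mirror v) f (mirror x))) (at x)"
    by (rule has_derivative_compose[OF bounded_linear_imp_has_derivative[OF bounded_linear_mirror]])
      (rule differentiable_has_derivative_along[OF assms])
  from bounded_linear.has_derivative[OF bounded_linear_mirror this] show ?thesis
    by (simp add: reflect_field_eq[abs_def])
qed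

lemma deriv_along_minus:
  assumes "f differentiable at x"
  shows "deriv_along (- v) f x = - deriv_along v f x"
  using bounded_linear.linear[OF has_derivative_bounded_linear[OF differentiable_has_derivative_along[OF assms]]]
  by (rule linear_neg)

lemma deriv_along_scaleR_left:
  assumes "f differentiable at x"
  shows "deriv_along (c *\<^sub>R v) f x = c *\<^sub>R deriv_along v f x"
  using bounded_linear.linear[OF has_derivative_bounded_linear[OF differentiable_has_derivative_along[OF assms]]]
  by (rule linear_scale)

lemma smooth_reflect_field: "smooth f \<Longrightarrow> smooth (reflect_field f)"
  using smooth_linear_compose[OF bounded_linear_mirror smooth_compose_linear[OF bounded_linear_mirror, of f]]
  by (simp add: reflect_field_eq[abs_def])

lemma mirror_scaleR: "mirror (c *\<^sub>R x) = c *\<^sub>R mirror x"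
  using linear_scale[OF bounded_linear.linear[OF bounded_linear_mirror]] .

lemma mirror_Basis: "v \<in> Basis \<Longrightarrow> \<exists>s\<in>{1,-1}. mirror v = s *\<^sub>R v"
  by (auto simp: Basis_vec_def mirror_axis)

text \<open>Each basis vector is an eigenvector of \<open>mirror\<close> with eigenvalue 1 or -1. A
  derivative of the reflected field is thus the reflected derivative up to a sign depending only on
  the multi-index, and the decay constants are unchanged.\<close>

lemma iter_deriv_reflect_field:
  assumes f: "smooth f" and "vs \<in> lists Basis"
  shows "\<exists>s\<in>{1,-1}. \<forall>x. iter_deriv vs (reflect_field f) x = s *\<^sub>R reflect_field (iter_deriv vs f) x"
  using assms(2)
proof (induction vs)
  case Nil
  show ?case by (rule bexI[of _ 1]) auto
next
  case (Cons v vs)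
  then obtain s where s: "s \<in> {1,-1}"
    and eq: "iter_deriv vs (reflect_field f) = (\<lambda>x. s *\<^sub>R reflect_field (iter_deriv vs f) x)"
    unfolding fun_eq_iff by blast
  obtain s' where s': "s' \<in> {1,-1}" "mirror v = s' *\<^sub>R v"
    using mirror_Basis[of v] Cons.hyps by blast
  have g: "smooth (iter_deriv vs f)" using f Cons by (auto intro: smooth_iter_deriv)
  have "iter_deriv (v # vs) (reflect_field f) x = (s * s') *\<^sub>R reflect_field (iter_deriv (v # vs) f) x" for x
  proof -
    have "((\<lambda>x. s *\<^sub>R reflect_field (iter_deriv vs f) x) has_derivative
        (\<lambda>v. s *\<^sub>R mirror (deriv_along (mirror v) (iter_deriv vs f) (mirror x)))) (at x)"
      by (intro has_derivative_scaleR_right deriv_along_reflect_field smooth_differentiable g)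
    then have "iter_deriv (v # vs) (reflect_field f) x = s *\<^sub>R mirror (deriv_along (mirror v) (iter_deriv vs f) (mirror x))"
      unfolding iter_deriv_Cons eq by (rule deriv_along_eq)
    then show ?thesis
      using s'(2) by (simp add: deriv_along_scaleR_left[OF smooth_differentiable[OF g]] mirror_scaleR iter_deriv_Cons reflect_field_eq)
  qed
  moreover have "s * s' \<in> {1,-1}" using s s' by auto
  ultimately show ?case by blast
qed

lemma periodic_reflect_field:
  "periodic_on UNIV periods f \<Longrightarrow> periodic_on UNIV periods (reflect_field f)"
  by (auto simp: periodic_on_def reflect_field_eq mirror_add mirror_periods)

lemma schwartz_reflect_field:
  assumes f: "f \<in> schwartz"
  shows "reflect_field f \<in> schwartz"
proof -
  have sm: "smooth f" using f by (simp add: schwartz_def)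
  have "\<exists>C. \<forall>x. norm (iter_deriv vs (reflect_field f) x) * \<bar>x $ 3\<bar> ^ k \<le> C" if vs: "vs \<in> lists Basis" for vs and k :: nat
  proof -
    obtain C where C: "\<And>x. norm (iter_deriv vs f x) * \<bar>x $ 3\<bar> ^ k \<le> C"
      using f vs unfolding schwartz_def by blast
    obtain s where "s \<in> {1,-1}" "\<And>x. iter_deriv vs (reflect_field f) x = s *\<^sub>R reflect_field (iter_deriv vs f) x"
      using iter_deriv_reflect_field[OF sm vs] by blast
    then have "norm (iter_deriv vs (reflect_field f) x) * \<bar>x $ 3\<bar> ^ k \<le> C" for x
      using C[of "mirror x"] by (auto simp: reflect_field_eq)
    then show ?thesis by blast
  qed
  then show ?thesis
    using f smooth_reflect_field periodic_reflect_field by (simp add: schwartz_def)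
qed

lemma schwartz_add:
  assumes f: "f \<in> schwartz" and g: "g \<in> schwartz"
  shows "(\<lambda>x. f x + g x) \<in> schwartz"
proof -
  have sm: "smooth f" "smooth g" using f g by (auto simp: schwartz_def)
  have "\<exists>C. \<forall>x. norm (iter_deriv vs (\<lambda>x. f x + g x) x) * \<bar>x $ 3\<bar> ^ k \<le> C" if vs: "vs \<in> lists Basis" for vs and k :: nat
  proof -
    obtain C where C: "\<And>x. norm (iter_deriv vs f x) * \<bar>x $ 3\<bar> ^ k \<le> C"
      using f vs unfolding schwartz_def by blast
    obtain C' where C': "\<And>x. norm (iter_deriv vs g x) * \<bar>x $ 3\<bar> ^ k \<le> C'"
      using g vs unfolding schwartz_def by blast
    have "norm (iter_deriv vs (\<lambda>x. f x + g x) x) * \<bar>x $ 3\<bar> ^ k \<le> C + C'" for x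
    proof -
      have "norm (iter_deriv vs (\<lambda>x. f x + g x) x) * \<bar>x $ 3\<bar> ^ k
          \<le> (norm (iter_deriv vs f x) + norm (iter_deriv vs g x)) * \<bar>x $ 3\<bar> ^ k"
        unfolding iter_deriv_add[OF sm vs] by (intro mult_right_mono norm_triangle_ineq) simp
      then show ?thesis using C[of x] C'[of x] by (simp add: distrib_right)
    qed
    then show ?thesis by blast
  qed
  then show ?thesis
    using f g smooth_add[OF sm] by (auto simp: schwartz_def periodic_on_def)
qed

lemma divergence_reflect_field:
  assumes "f differentiable at (mirror x)"
  shows "divergence (reflect_field f) x = divergence f (mirror x)"
  using deriv_along_eq[OF deriv_along_reflect_field[OF assms]]
  by (simp add: divergence_def sum_3 mirror_axis deriv_along_minus[OF assms])

lemma divergence_add: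
  assumes "f differentiable at x" "g differentiable at x"
  shows "divergence (\<lambda>x. f x + g x) x = divergence f x + divergence g x"
  by (simp add: divergence_def deriv_along_add[OF assms] sum.distrib)

section \<open>Decay in the normal variable and square integrability\<close>

lemma schwartz_bound:
  assumes f: "f \<in> schwartz"
  obtains C where "0 < C" "\<And>x. norm (f x) \<le> C / (1 + \<bar>x $ 3\<bar>)\<^sup>2"
proof -
  have *: "\<exists>C. \<forall>x. norm (f x) * \<bar>x $ 3\<bar> ^ k \<le> C" for k :: nat
    using f by (auto simp: schwartz_def dest!: bspec[of _ _ "[]"])
  obtain C0 where C0: "\<And>x. norm (f x) * \<bar>x $ 3\<bar> ^ 0 \<le> C0" using * by blast
  obtain C2 where C2: "\<And>x. norm (f x) * \<bar>x $ 3\<bar> ^ 2 \<le> C2" using * by blast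
  have nn: "0 \<le> C0" "0 \<le> C2"
    using order_trans[OF mult_nonneg_nonneg C0] order_trans[OF mult_nonneg_nonneg C2] by auto
  \<comment> \<open>Uses (1 + a)^2 <= 2 + 2 a^2 with the bounds for the powers 0 and 2; the summand
    1 makes the constant strictly positive.\<close>
  have "norm (f x) \<le> (2 * C0 + 2 * C2 + 1) / (1 + \<bar>x $ 3\<bar>)\<^sup>2" for x
  proof -
    have "norm (f x) * (1 + \<bar>x $ 3\<bar>)\<^sup>2 \<le> norm (f x) * (2 + 2 * \<bar>x $ 3\<bar>\<^sup>2)"
      using sum_squares_bound[of 1 "\<bar>x $ 3\<bar>"] by (intro mult_left_mono) (simp_all add: power2_sum)
    also have "\<dots> \<le> 2 * C0 + 2 * C2 + 1" using C0[of x] C2[of x] by (simp add: algebra_simps)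
    finally show ?thesis by (simp add: pos_le_divide_eq)
  qed
  then show ?thesis using that[of "2 * C0 + 2 * C2 + 1"] nn by simp
qed

text \<open>The half cell is covered by the closed slabs of height 1 over [0, 2 pi]^2, each of
  volume 4 pi^2, and the integrand is at most 1/(1+k)^2 on the k-th one. Overlapping faces do no
  harm since only an upper bound is required.\<close>

lemma integrable_decay: "integrable (vol D_plus) (\<lambda>x. 1 / (1 + \<bar>x $ 3\<bar>)\<^sup>2)"
proof (rule integrableI_bounded)
  define f :: "real^3 \<Rightarrow> real" where "f x = 1 / (1 + \<bar>x $ 3\<bar>)\<^sup>2" for x
  have "continuous_on UNIV f"
    unfolding f_def by (intro continuous_intros) (auto simp: add_nonneg_eq_0_iff)
  then have fb: "f \<in> borel_measurable lebesgue"
    by (intro measurable_completion) (simp add: borel_measurable_continuous_onI)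
  then show "(\<lambda>x. 1 / (1 + \<bar>x $ 3\<bar>)\<^sup>2) \<in> borel_measurable (vol D_plus)"
    unfolding f_def[abs_def] vol_def by (rule measurable_restrict_space1)
  define slab :: "nat \<Rightarrow> (real^3) set" where
    "slab k = cbox (vector [0, 0, real k]) (vector [2 * pi, 2 * pi, real k + 1])" for k
  have slab_meas: "emeasure lebesgue (slab k) = ennreal (4 * pi\<^sup>2)" for k
  proof -
    have "slab k \<noteq> {}" by (auto simp: slab_def interval_ne_empty_cart forall_3 vector_3)
    then have "measure lborel (slab k) =
        (\<Prod>i\<in>UNIV. (vector [2 * pi, 2 * pi, real k + 1] :: real^3) $ i - (vector [0, 0, real k] :: real^3) $ i)"
      unfolding slab_def by (rule content_cbox_cart)
    also have "\<dots> = 4 * pi\<^sup>2"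
      unfolding UNIV_3 by (simp add: vector_3 power2_eq_square)
    finally have "measure lborel (slab k) = 4 * pi\<^sup>2" .
    moreover have "emeasure lborel (slab k) \<noteq> top"
      unfolding slab_def using emeasure_lborel_cbox_finite by (metis infinity_ennreal_def less_irrefl)
    ultimately have "emeasure lborel (slab k) = ennreal (4 * pi\<^sup>2)"
      by (simp add: emeasure_eq_ennreal_measure)
    then show ?thesis by (simp add: slab_def)
  qed
  define c where "c k = 4 * pi\<^sup>2 / (1 + real k)\<^sup>2" for k :: nat
  \<comment> \<open>The series of 1/k^2 starts at k = 0 with the default value inverse 0 = 0; the
    shift to \<open>Suc k\<close> drops that term.\<close>
  have "summable (\<lambda>k. inverse (real (Suc k) ^ 2))"
    using inverse_power_summable[of 2, where ?'a = real] by (simp add: summable_Suc_iff[of "\<lambda>k. inverse (real k ^ 2)"] del: of_nat_Suc)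
  then have "summable (\<lambda>k. 4 * pi\<^sup>2 * inverse (real (Suc k) ^ 2))" by (rule summable_mult)
  then have sc: "summable c" by (simp add: c_def[abs_def] divide_inverse add.commute)
  have "(\<integral>\<^sup>+ x. ennreal (norm (f x)) \<partial>vol D_plus) = (\<integral>\<^sup>+ x. ennreal (f x) * indicator (D_plus \<inter> cell) x \<partial>lebesgue)"
    using D_plus_cell_sets by (simp add: vol_def nn_integral_restrict_space f_def)
  also have "\<dots> \<le> (\<integral>\<^sup>+ x. (\<Sum>k. ennreal (1 / (1 + real k)\<^sup>2) * indicator (slab k) x) \<partial>lebesgue)"
  proof (intro nn_integral_mono)
    fix x :: "real^3"
    show "ennreal (f x) * indicator (D_plus \<inter> cell) x \<le> (\<Sum>k. ennreal (1 / (1 + real k)\<^sup>2) * indicator (slab k) x)"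
    proof (cases "x \<in> D_plus \<inter> cell")
      case True
      define k where "k = nat \<lfloor>x $ 3\<rfloor>"
      have x3: "0 \<le> x $ 3" using True by (simp add: D_plus_def)
      have k: "real k \<le> x $ 3" "x $ 3 \<le> real k + 1" using x3 by (simp_all add: k_def)
      have "x \<in> slab k"
        using True k by (auto simp: slab_def mem_box_cart forall_3 vector_3 cell_def)
      moreover have "f x \<le> 1 / (1 + real k)\<^sup>2"
        unfolding f_def using k x3 by (intro divide_left_mono power_mono mult_pos_pos zero_less_power) auto
      ultimately have "ennreal (f x) * indicator (D_plus \<inter> cell) x \<le> (\<Sum>k\<in>{k}. ennreal (1 / (1 + real k)\<^sup>2) * indicator (slab k) x)"
        using True by (simp add: ennreal_leI)
      also have "\<dots> \<le> (\<Sum>k. ennreal (1 / (1 + real k)\<^sup>2) * indicator (slab k) x)"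
        by (rule sum_le_suminf) auto
      finally show ?thesis .
    qed simp
  qed
  also have "\<dots> = (\<Sum>k. \<integral>\<^sup>+ x. ennreal (1 / (1 + real k)\<^sup>2) * indicator (slab k) x \<partial>lebesgue)"
  proof (rule nn_integral_suminf)
    fix k
    have [measurable]: "slab k \<in> sets lebesgue" by (simp add: slab_def)
    show "(\<lambda>x. ennreal (1 / (1 + real k)\<^sup>2) * indicator (slab k) x) \<in> borel_measurable lebesgue" by measurable
  qed
  also have "\<dots> = (\<Sum>k. ennreal (c k))"
  proof (rule suminf_cong)
    fix k
    have "slab k \<in> sets lebesgue" by (simp add: slab_def)
    then have "(\<integral>\<^sup>+ x. ennreal (1 / (1 + real k)\<^sup>2) * indicator (slab k) x \<partial>lebesgue) = ennreal (1 / (1 + real k)\<^sup>2) * ennreal (4 * pi\<^sup>2)"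
      unfolding slab_meas[of k, symmetric] by (rule nn_integral_cmult_indicator)
    also have "\<dots> = ennreal (c k)"
      by (subst ennreal_mult'[symmetric]) (simp_all add: c_def)
    finally show "(\<integral>\<^sup>+ x. ennreal (1 / (1 + real k)\<^sup>2) * indicator (slab k) x \<partial>lebesgue) = ennreal (c k)" .
  qed
  also have "\<dots> < \<infinity>"
    unfolding infinity_ennreal_def less_top[symmetric]
    by (rule ennreal_suminf_neq_top[OF sc]) (simp add: c_def)
  finally show "(\<integral>\<^sup>+ x. ennreal (norm (1 / (1 + \<bar>x $ 3\<bar>)\<^sup>2)) \<partial>vol D_plus) < \<infinity>"
    by (simp add: f_def)
qed

lemma integrable_decay_full: "integrable (vol D_full) (\<lambda>x. 1 / (1 + \<bar>x $ 3\<bar>)\<^sup>2)"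
proof -
  note h = has_bochner_integral_integrable[OF integrable_decay]
  show ?thesis by (rule integrable.intros, rule has_bochner_integral_full[OF h h]) auto
qed

lemma borel_measurable_vol_continuous:
  assumes "continuous_on UNIV f"
  shows "f \<in> borel_measurable (vol \<Omega>)"
  unfolding vol_def
  by (intro measurable_restrict_space1 measurable_completion) (simp add: borel_measurable_continuous_onI assms)

lemma schwartz_L2:
  assumes f: "f \<in> schwartz"
  shows "f \<in> L2 D_full"
proof -
  have c: "continuous_on UNIV f" using f by (auto simp: schwartz_def intro: smooth_continuous_on)
  obtain C where C: "0 < C" "\<And>x. norm (f x) \<le> C / (1 + \<bar>x $ 3\<bar>)\<^sup>2" using schwartz_bound[OF f] by blast
  have "integrable (vol D_full) (\<lambda>x. (norm (f x))\<^sup>2)"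
  proof (rule Bochner_Integration.integrable_bound)
    show "integrable (vol D_full) (\<lambda>x. C\<^sup>2 * (1 / (1 + \<bar>x $ 3\<bar>)\<^sup>2))"
      using integrable_decay_full by (rule integrable_mult_right)
    show "(\<lambda>x. (norm (f x))\<^sup>2) \<in> borel_measurable (vol D_full)"
      using c by (intro borel_measurable_vol_continuous continuous_intros)
    have "(norm (f x))\<^sup>2 \<le> C\<^sup>2 * (1 / (1 + \<bar>x $ 3\<bar>)\<^sup>2)" for x
    proof -
      have "norm (f x) \<le> C / (1 + \<bar>x $ 3\<bar>)"
        using C(1) by (intro order_trans[OF C(2)] divide_left_mono) (auto intro: self_le_power)
      then have "(norm (f x))\<^sup>2 \<le> (C / (1 + \<bar>x $ 3\<bar>))\<^sup>2" by (intro power_mono) auto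
      then show ?thesis by (simp add: power_divide)
    qed
    then show "AE x in vol D_full. norm ((norm (f x))\<^sup>2) \<le> norm (C\<^sup>2 * (1 / (1 + \<bar>x $ 3\<bar>)\<^sup>2))" by simp
  qed
  then show ?thesis
    using f borel_measurable_vol_continuous[OF c] by (simp add: L2_def schwartz_def D_full_def)
qed


section \<open>Averages over segments normal to the boundary\<close>

definition squash :: "real \<Rightarrow> real^3 \<Rightarrow> real^3" where
  "squash s x = vector [x $ 1, x $ 2, s * x $ 3]"

text \<open>For k = 0, x_3 times this average is the integral of g along the normal segment from the
  boundary to x. Rescaling to [0,1] fixes the domain of integration, so differentiation under the
  integral applies on all of R^3; the weight \<open>s ^ k\<close> is there to record normal
  derivatives.\<close>

definition ray_mean :: "nat \<Rightarrow> (real^3 \<Rightarrow> real^3) \<Rightarrow> real^3 \<Rightarrow> real^3" where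
  "ray_mean k g x = integral {0..1} (\<lambda>s. s ^ k *\<^sub>R g (squash s x))"

lemma squash_nth [simp]: "squash s x $ 1 = x $ 1" "squash s x $ 2 = x $ 2" "squash s x $ 3 = s * x $ 3"
  by (simp_all add: squash_def vector_3)

lemma bounded_linear_squash: "bounded_linear (squash s)"
  unfolding linear_conv_bounded_linear[symmetric]
  by (rule linearI) (simp_all add: vec_eq_iff forall_3 algebra_simps)

lemma squash_eq: "squash s x = squash 0 x + s *\<^sub>R axis 3 (x $ 3)"
  by (simp add: vec_eq_iff forall_3 axis_def)

lemma squash_1 [simp]: "squash 1 x = x"
  by (simp add: vec_eq_iff forall_3)

lemma continuous_on_squash [continuous_intros]:
  assumes "continuous_on S f" "continuous_on S g"
  shows "continuous_on S (\<lambda>z. squash (f z) (g z))"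
proof -
  have "continuous_on S (\<lambda>z. \<chi> i. if i = 3 then f z * g z $ 3 else g z $ i)"
  proof (intro continuous_on_vec_lambda)
    fix i :: 3
    show "continuous_on S (\<lambda>z. if i = 3 then f z * g z $ 3 else g z $ i)"
      by (cases "i = 3") (auto intro!: continuous_intros assms)
  qed
  also have "(\<lambda>z. \<chi> i. if i = 3 then f z * g z $ 3 else g z $ i) = (\<lambda>z. squash (f z) (g z))"
    by (auto simp: vec_eq_iff forall_3)
  finally show ?thesis .
qed

lemma squash_inner_Basis:
  "b \<in> Basis \<Longrightarrow> squash s v \<bullet> b = (if b = axis 3 1 then s else 1) * (v \<bullet> b)"
proof -
  assume "b \<in> Basis"
  then obtain i where i: "b = axis i 1" by (auto simp: Basis_vec_def)
  have "i = 1 \<or> i = 2 \<or> i = 3" by (rule exhaust_3)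
  then show ?thesis unfolding i by (elim disjE) (simp_all add: inner_axis axis_eq_axis)
qed

text \<open>The Leibniz rule asks for the derivative of the integrand as a bounded linear map
  depending continuously on (x, s). Expanding it in partial derivatives reduces that continuity to
  the smoothness of g.\<close>

lemma ray_mean_has_derivative:
  assumes g: "smooth g"
  shows "(ray_mean k g has_derivative (\<lambda>v. integral {0..1} (\<lambda>s. s ^ k *\<^sub>R deriv_along (squash s v) g (squash s x)))) (at x)"
proof -
  \<comment> \<open>\<open>w b s\<close> is the eigenvalue of \<open>squash s\<close> on the basis
    vector b.\<close>
  define w :: "real^3 \<Rightarrow> real \<Rightarrow> real" where "w b s = (if b = axis 3 1 then s else 1)" for b s
  define fx where "fx x s = (\<Sum>b\<in>Basis. blinfun_scaleR_left (s ^ k *\<^sub>R w b s *\<^sub>R deriv_along b g (squash s x)) o\<^sub>L blinfun_inner_left b)" for x s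
  have fx: "blinfun_apply (fx x s) v = s ^ k *\<^sub>R deriv_along (squash s v) g (squash s x)" for x s v
  proof -
    have "deriv_along (squash s v) g (squash s x) = (\<Sum>b\<in>Basis. (w b s * (v \<bullet> b)) *\<^sub>R deriv_along b g (squash s x))"
      by (subst deriv_along_sum_Basis[OF smooth_differentiable[OF g]])
        (auto intro!: sum.cong simp: squash_inner_Basis w_def)
    then show ?thesis
      by (simp add: fx_def blinfun.sum_left scaleR_sum_right mult_ac inner_commute)
  qed
  have cont_w: "continuous_on S (w b)" for S b
    unfolding w_def by (cases "b = axis 3 1") (auto intro!: continuous_intros)
  have cont_d: "continuous_on S (deriv_along b g)" if "b \<in> Basis" for b S
    using that by (intro smooth_continuous_on smooth_deriv_along g)
  have cont: "continuous_on (UNIV \<times> cbox 0 1) (\<lambda>(x, s). fx x s)"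
    unfolding fx_def split_beta
    by (intro continuous_intros bounded_linear.continuous_on[OF bounded_linear_blinfun_scaleR_left]
        continuous_on_compose2[OF cont_w[of UNIV]] continuous_on_compose2[OF cont_d[of _ UNIV]]) auto
  have gc: "continuous_on {0..1} (\<lambda>s. s ^ k *\<^sub>R g (squash s x))" for x
    by (intro continuous_intros continuous_on_compose2[OF smooth_continuous_on[OF g, of UNIV]]) auto
  have D: "((\<lambda>x. s ^ k *\<^sub>R g (squash s x)) has_derivative blinfun_apply (fx x s)) (at x within UNIV)" for x s
  proof -
    have "((\<lambda>x. g (squash s x)) has_derivative (\<lambda>v. deriv_along (squash s v) g (squash s x))) (at x)"
      by (rule has_derivative_compose[OF bounded_linear_imp_has_derivative[OF bounded_linear_squash] smooth_has_derivative[OF g]])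
    then show ?thesis unfolding fx[abs_def] by (auto intro!: derivative_eq_intros simp: fx)
  qed
  have "((\<lambda>x. integral (cbox 0 1) (\<lambda>s. s ^ k *\<^sub>R g (squash s x))) has_derivative blinfun_apply (integral (cbox 0 1) (fx x))) (at x within UNIV)"
    by (rule leibniz_rule[OF D _ cont]) (use gc in \<open>auto intro!: integrable_continuous_real\<close>)
  moreover have "fx x integrable_on cbox 0 1"
  proof (rule integrable_continuous)
    show "continuous_on (cbox 0 1) (fx x)"
    proof -
      have "continuous_on (cbox 0 1) (\<lambda>s::real. (x, s))" by (intro continuous_intros)
      from continuous_on_compose2[OF cont this] show ?thesis by auto
    qed
  qed
  then have "blinfun_apply (integral (cbox 0 1) (fx x)) = (\<lambda>v. integral {0..1} (\<lambda>s. s ^ k *\<^sub>R deriv_along (squash s v) g (squash s x)))"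
    by (simp add: fun_eq_iff blinfun_apply_integral fx)
  ultimately show ?thesis
    by (simp add: ray_mean_def[abs_def])
qed

text \<open>Since \<open>squash s\<close> multiplies the third basis vector by s and fixes the
  others, a normal derivative raises the weight by one and a horizontal one keeps it. The averages
  are thus closed under differentiation, which gives their smoothness by induction.\<close>

lemma deriv_along_ray_mean:
  assumes g: "smooth g" and b: "b \<in> Basis"
  shows "deriv_along b (ray_mean k g) = ray_mean (if b = axis 3 1 then Suc k else k) (deriv_along b g)"
proof
  fix x
  obtain i where i: "b = axis i 1" using b by (auto simp: Basis_vec_def)
  have sq: "squash s b = (if b = axis 3 1 then s else 1) *\<^sub>R b" for s
    by (rule euclidean_eqI) (auto simp: squash_inner_Basis inner_Basis b)
  have "deriv_along b (ray_mean k g) x = integral {0..1} (\<lambda>s. s ^ k *\<^sub>R deriv_along (squash s b) g (squash s x))"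
    by (rule deriv_along_eq[OF ray_mean_has_derivative[OF g]])
  also have "\<dots> = ray_mean (if b = axis 3 1 then Suc k else k) (deriv_along b g) x"
    unfolding sq ray_mean_def deriv_along_scaleR_left[OF smooth_differentiable[OF g]]
    by (auto simp: mult.commute)
  finally show "deriv_along b (ray_mean k g) x = ray_mean (if b = axis 3 1 then Suc k else k) (deriv_along b g) x" .
qed

lemma smooth_ray_mean:
  assumes "smooth g"
  shows "smooth (ray_mean k g)"
proof -
  have "n_smooth n (ray_mean k g)" for n
    using assms
  proof (induction n arbitrary: g k)
    case 0
    then show ?case using differentiableI[OF ray_mean_has_derivative[OF "0.prems"]] by simp
  next
    case (Suc n)
    have "n_smooth n (deriv_along b (ray_mean k g))" if b: "b \<in> Basis" for b
      unfolding deriv_along_ray_mean[OF Suc.prems b] by (intro Suc.IH smooth_deriv_along Suc.prems b)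
    then show ?case using differentiableI[OF ray_mean_has_derivative[OF Suc.prems]] by simp
  qed
  then show ?thesis by (simp add: smooth_iff_n_smooth)
qed

lemma squash_continuous_integrable:
  fixes g :: "real^3 \<Rightarrow> 'b::banach"
  shows "continuous_on UNIV g \<Longrightarrow> (\<lambda>s. g (squash s x)) integrable_on {0..1}"
  by (rule integrable_continuous_real, erule continuous_on_compose2) (auto intro!: continuous_intros)

lemma axis_in_Basis_vec: "axis i (1::real) \<in> Basis"
  by (auto simp: Basis_vec_def)

text \<open>The divergence condition turns the horizontal divergence of the average into a normal derivative,
  which is then integrated along the segment.\<close>

lemma horizontal_divergence_ray_mean:
  assumes g: "smooth g" and div: "\<And>x. x \<in> D_plus \<Longrightarrow> divergence g x = 0"
    and bd: "\<And>x. x $ 3 = 0 \<Longrightarrow> g x $ 3 = 0" and x: "0 \<le> x $ 3"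
  shows "x $ 3 * (deriv_along (axis 1 1) (ray_mean 0 g) x $ 1 + deriv_along (axis 2 1) (ray_mean 0 g) x $ 2) = - (g x $ 3)"
proof -
  let ?d = "\<lambda>i. deriv_along (axis i 1) g"
  have int: "(\<lambda>s. ?d i (squash s x)) integrable_on {0..1}" for i
    by (intro squash_continuous_integrable smooth_continuous_on smooth_deriv_along g axis_in_Basis_vec)
  have comp: "integral {0..1} (\<lambda>s. ?d i (squash s x)) $ j = integral {0..1} (\<lambda>s. ?d i (squash s x) $ j)" for i j
    by (rule integral_component_eq_cart[OF int, symmetric])
  have intc: "(\<lambda>s. ?d i (squash s x) $ j) integrable_on {0..1}" for i j
    by (intro squash_continuous_integrable continuous_intros smooth_continuous_on smooth_deriv_along g axis_in_Basis_vec)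
  have "((\<lambda>s. x $ 3 * ?d 3 (squash s x) $ 3) has_integral (g (squash 1 x) $ 3 - g (squash 0 x) $ 3)) {0..1}"
  proof (rule fundamental_theorem_of_calculus)
    fix s :: real
    have 1: "((\<lambda>s. squash s x) has_vector_derivative axis 3 (x $ 3)) (at s within {0..1})"
      by (subst squash_eq) (auto intro!: derivative_eq_intros)
    have "((\<lambda>s. g (squash s x)) has_vector_derivative deriv_along (axis 3 (x $ 3)) g (squash s x)) (at s within {0..1})"
      by (rule vector_derivative_diff_chain_within[OF 1, unfolded o_def])
        (rule has_derivative_at_withinI[OF smooth_has_derivative[OF g]])
    from bounded_linear.has_vector_derivative[OF bounded_linear_vec_nth[of 3] this]
    have "((\<lambda>s. g (squash s x) $ 3) has_vector_derivative deriv_along (axis 3 (x $ 3)) g (squash s x) $ 3) (at s within {0..1})" .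
    moreover have "axis 3 (x $ 3) = (x $ 3) *\<^sub>R (axis 3 1 :: real^3)"
      by (simp add: vec_eq_iff axis_def)
    ultimately show "((\<lambda>s. g (squash s x) $ 3) has_vector_derivative x $ 3 * ?d 3 (squash s x) $ 3) (at s within {0..1})"
      by (simp add: deriv_along_scaleR_left[OF smooth_differentiable[OF g]])
  qed simp
  from integral_unique[OF this]
  have ftc: "integral {0..1} (\<lambda>s. x $ 3 * ?d 3 (squash s x) $ 3) = g x $ 3"
    using bd[of "squash 0 x"] by simp
  \<comment> \<open>The segment from the boundary to x stays in \<open>D_plus\<close>, the only
    region where g is assumed solenoidal.\<close>
  have d: "?d 1 (squash s x) $ 1 + ?d 2 (squash s x) $ 2 = - (?d 3 (squash s x) $ 3)" if "s \<in> {0..1}" for s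
    using div[of "squash s x"] that x by (simp add: divergence_def sum_3 D_plus_def)
  have "deriv_along (axis 1 1) (ray_mean 0 g) x $ 1 + deriv_along (axis 2 1) (ray_mean 0 g) x $ 2
      = integral {0..1} (\<lambda>s. ?d 1 (squash s x) $ 1) + integral {0..1} (\<lambda>s. ?d 2 (squash s x) $ 2)"
    by (simp add: deriv_along_ray_mean[OF g axis_in_Basis_vec] axis_eq_axis ray_mean_def comp)
  also have "\<dots> = integral {0..1} (\<lambda>s. ?d 1 (squash s x) $ 1 + ?d 2 (squash s x) $ 2)"
    by (rule integral_add[symmetric]) (rule intc)+
  also have "\<dots> = integral {0..1} (\<lambda>s. - (?d 3 (squash s x) $ 3))"
    by (rule integral_cong) (rule d)
  finally show ?thesis using ftc by simp
qed

text \<open>Averaging C/(1+sz)^2 over s in [0,1] gives exactly C/(1+z), still square integrable in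
  z; starting from exponent 1 would leave a logarithm.\<close>

lemma ray_mean_bound:
  assumes g: "smooth g" and C: "\<And>x. norm (g x) \<le> C / (1 + \<bar>x $ 3\<bar>)\<^sup>2" and x: "0 \<le> x $ 3"
  shows "norm (ray_mean 0 g x) \<le> C / (1 + x $ 3)"
proof -
  have ne: "1 + s * x $ 3 \<noteq> 0" if "s \<in> {0..1}" for s
    using that x by (smt (verit) atLeastAtMost_iff mult_nonneg_nonneg)
  \<comment> \<open>The primitive C s/(1+sz) is chosen because it contains no division by z and
    covers z = 0.\<close>
  have "((\<lambda>s. C / (1 + s * x $ 3)\<^sup>2) has_integral (C * 1 / (1 + 1 * x $ 3) - C * 0 / (1 + 0 * x $ 3))) {0..1}"
  proof (rule fundamental_theorem_of_calculus)
    fix s :: real assume s: "s \<in> {0..1}"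
    have "((\<lambda>s. C * s / (1 + s * x $ 3)) has_real_derivative C / (1 + s * x $ 3)\<^sup>2) (at s within {0..1})"
      using ne[OF s] by (auto intro!: derivative_eq_intros simp: field_simps power2_eq_square)
    then show "((\<lambda>s. C * s / (1 + s * x $ 3)) has_vector_derivative C / (1 + s * x $ 3)\<^sup>2) (at s within {0..1})"
      by (simp add: has_real_derivative_iff_has_vector_derivative)
  qed simp
  then have I: "((\<lambda>s. C / (1 + s * x $ 3)\<^sup>2) has_integral C / (1 + x $ 3)) {0..1}" by simp
  have "norm (integral {0..1} (\<lambda>s. g (squash s x))) \<le> integral {0..1} (\<lambda>s. C / (1 + s * x $ 3)\<^sup>2)"
  proof (rule integral_norm_bound_integral)
    show "(\<lambda>s. g (squash s x)) integrable_on {0..1}"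
      by (intro squash_continuous_integrable smooth_continuous_on g)
    show "(\<lambda>s. C / (1 + s * x $ 3)\<^sup>2) integrable_on {0..1}" using I by blast
    show "norm (g (squash s x)) \<le> C / (1 + s * x $ 3)\<^sup>2" if "s \<in> {0..1}" for s
      using C[of "squash s x"] that x by (simp add: abs_mult)
  qed
  then show ?thesis using integral_unique[OF I] by (simp add: ray_mean_def)
qed


section \<open>Solenoidal cutoffs\<close>

lemma deriv_along_real_eq:
  "(h has_real_derivative d) (at z) \<Longrightarrow> deriv_along v h z = d * v"
  unfolding has_field_derivative_def by (rule deriv_along_eq)

lemma smooth_has_real_derivative:
  assumes "smooth (h :: real \<Rightarrow> real)"
  shows "(h has_real_derivative deriv_along 1 h z) (at z)"
proof -
  obtain d where d: "(h has_real_derivative d) (at z)"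
    using smooth_differentiable[OF assms] real_differentiable_def by blast
  then show ?thesis using deriv_along_real_eq[OF d, of 1] by simp
qed

definition step_deriv :: "real \<Rightarrow> real" where
  "step_deriv = deriv_along 1 smooth_step"

lemma smooth_step_deriv: "smooth step_deriv"
  unfolding step_deriv_def by (rule smooth_deriv_along[OF smooth_smooth_step]) simp

lemma smooth_step_has_real_derivative: "(smooth_step has_real_derivative step_deriv y) (at y)"
  unfolding step_deriv_def by (rule smooth_has_real_derivative[OF smooth_smooth_step])

lemma step_deriv_eq_0: "y < 1 \<or> 2 < y \<Longrightarrow> step_deriv y = 0"
proof (elim disjE)
  assume "y < 1"
  have "(smooth_step has_real_derivative 0) (at y)"
    by (rule has_field_derivative_transform_within_open[of "\<lambda>_. 0" _ _ "{..<1}"])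
      (use \<open>y < 1\<close> in \<open>auto simp: smooth_step_eq_0\<close>)
  then show ?thesis using DERIV_unique smooth_step_has_real_derivative by blast
next
  assume "2 < y"
  have "(smooth_step has_real_derivative 0) (at y)"
    by (rule has_field_derivative_transform_within_open[of "\<lambda>_. 1" _ _ "{2<..}"])
      (use \<open>2 < y\<close> in \<open>auto simp: smooth_step_eq_1\<close>)
  then show ?thesis using DERIV_unique smooth_step_has_real_derivative by blast
qed

text \<open>The derivative is continuous and vanishes outside the compact interval [1,2].\<close>

lemma step_deriv_bound: obtains B where "0 \<le> B" "\<And>y. \<bar>y * step_deriv y\<bar> \<le> B"
proof -
  have "compact ((\<lambda>y. y * step_deriv y) ` {1..2})"
    by (intro compact_continuous_image continuous_intros smooth_continuous_on smooth_step_deriv) simp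
  then obtain B where "\<forall>y\<in>{1..2}. \<bar>y * step_deriv y\<bar> \<le> B"
    using compact_imp_bounded[of "(\<lambda>y. y * step_deriv y) ` {1..2}"] unfolding bounded_iff by auto
  then have B: "\<bar>y * step_deriv y\<bar> \<le> B" if "y \<in> {1..2}" for y using that by blast
  have "0 \<le> B" using B[of 1] by auto
  moreover have "\<bar>y * step_deriv y\<bar> \<le> B" for y
    using B[of y] step_deriv_eq_0[of y] \<open>0 \<le> B\<close> by (cases "y \<in> {1..2}") (auto simp: not_le)
  ultimately show ?thesis using that by blast
qed

text \<open>The first factor rises between 1/m and 2/m, the second falls between m and 2m. Both are
  dilations of the same step.\<close>

definition cutoff :: "real \<Rightarrow> real \<Rightarrow> real" where
  "cutoff m z = smooth_step (m * z) * (1 - smooth_step (z / m))"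

definition cutoff_deriv :: "real \<Rightarrow> real \<Rightarrow> real" where
  "cutoff_deriv m z = m * step_deriv (m * z) * (1 - smooth_step (z / m)) - smooth_step (m * z) * (step_deriv (z / m) / m)"

lemma cutoff_has_real_derivative: "(cutoff m has_real_derivative cutoff_deriv m z) (at z)"
proof -
  have 1: "((\<lambda>z. smooth_step (m * z)) has_real_derivative step_deriv (m * z) * m) (at z)"
    by (rule DERIV_chain2[OF smooth_step_has_real_derivative]) (auto intro!: derivative_eq_intros)
  \<comment> \<open>For m = 0 the convention x / 0 = 0 makes the function constant and the claimed
    derivative 0, so the formula holds for every m.\<close>
  have 2: "((\<lambda>z. smooth_step (z / m)) has_real_derivative step_deriv (z / m) * (1 / m)) (at z)"
    by (rule DERIV_chain2[OF smooth_step_has_real_derivative]) (cases "m = 0"; auto intro!: derivative_eq_intros)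
  show ?thesis
    unfolding cutoff_def[abs_def] cutoff_deriv_def
    by (rule DERIV_cong[OF DERIV_mult[OF 1 DERIV_diff[OF DERIV_const 2]]]) (simp add: algebra_simps)
qed

lemma smooth_cutoff: "smooth (cutoff m)"
proof -
  have 1: "smooth (\<lambda>z. smooth_step (m * z))"
    by (rule smooth_compose_linear[OF bounded_linear_mult_right smooth_smooth_step])
  have 2: "smooth (\<lambda>z. smooth_step (z / m))"
    by (rule smooth_compose_linear[OF bounded_linear_divide smooth_smooth_step])
  have "smooth (\<lambda>z. smooth_step (m * z) * (1 + (-1) * smooth_step (z / m)))"
    by (intro smooth_mult smooth_add smooth_const 1 2)
  then show ?thesis by (simp add: cutoff_def[abs_def])
qed

lemma cutoff_deriv_eq: "cutoff_deriv m = deriv_along 1 (cutoff m)"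
  using deriv_along_real_eq[OF cutoff_has_real_derivative] by (auto simp: fun_eq_iff)

lemma smooth_cutoff_deriv: "smooth (cutoff_deriv m)"
  unfolding cutoff_deriv_eq by (rule smooth_deriv_along[OF smooth_cutoff]) simp

lemma cutoff_bounds: "0 \<le> cutoff m z" "cutoff m z \<le> 1"
  unfolding cutoff_def using smooth_step_bounds[of "m * z"] smooth_step_bounds[of "z / m"]
  by (auto intro: mult_le_one)

lemma cutoff_below:
  assumes "0 < m" "z \<le> 0"
  shows "cutoff m z = 0" "cutoff_deriv m z = 0"
proof -
  have "m * z \<le> 0" using assms by (simp add: mult_nonneg_nonpos)
  then show "cutoff m z = 0" "cutoff_deriv m z = 0"
    by (simp_all add: cutoff_def cutoff_deriv_def smooth_step_eq_0 step_deriv_eq_0)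
qed

lemma cutoff_above:
  assumes "1 \<le> m" "2 * m < z"
  shows "cutoff m z = 0" "cutoff_deriv m z = 0"
proof -
  have 1: "2 < z / m" using assms by (simp add: pos_less_divide_eq)
  have "1 * z \<le> m * z" using assms by (intro mult_right_mono) auto
  then have "2 < m * z" using assms by linarith
  with 1 show "cutoff m z = 0" "cutoff_deriv m z = 0"
    by (simp_all add: cutoff_def cutoff_deriv_def smooth_step_eq_1 step_deriv_eq_0)
qed

lemma cutoff_middle:
  assumes "2 < m * z" "z < m" "0 < m"
  shows "cutoff m z = 1" "cutoff_deriv m z = 0"
  using assms by (simp_all add: cutoff_def cutoff_deriv_def smooth_step_eq_1 smooth_step_eq_0 step_deriv_eq_0)

text \<open>Multiplication by z makes the derivative dilation invariant: the two terms are y times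
  the step derivative at y = mz and at y = z/m, each with a factor in [0,1]. The bound therefore
  does not depend on m.\<close>

lemma cutoff_deriv_bound:
  assumes B: "\<And>y. \<bar>y * step_deriv y\<bar> \<le> B" and m: "0 < m"
  shows "\<bar>z * cutoff_deriv m z\<bar> \<le> 2 * B"
proof -
  have eq: "z * cutoff_deriv m z = (m * z) * step_deriv (m * z) * (1 - smooth_step (z / m)) - smooth_step (m * z) * ((z / m) * step_deriv (z / m))"
    by (simp add: cutoff_deriv_def algebra_simps)
  have "\<bar>(m * z) * step_deriv (m * z) * (1 - smooth_step (z / m))\<bar> \<le> B * 1"
    unfolding abs_mult[of _ "1 - smooth_step (z / m)"]
    by (intro mult_mono B) (use smooth_step_bounds[of "z / m"] order_trans[OF abs_ge_zero B] in auto)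
  moreover have "\<bar>smooth_step (m * z) * ((z / m) * step_deriv (z / m))\<bar> \<le> 1 * B"
    unfolding abs_mult[of "smooth_step (m * z)"]
    by (intro mult_mono B) (use smooth_step_bounds[of "m * z"] in auto)
  ultimately have "\<bar>(m * z) * step_deriv (m * z) * (1 - smooth_step (z / m))\<bar>
      + \<bar>smooth_step (m * z) * ((z / m) * step_deriv (z / m))\<bar> \<le> B * 1 + 1 * B"
    by (rule add_mono)
  then show ?thesis unfolding eq by (intro order_trans[OF abs_triangle_ineq4]) simp
qed

section \<open>The compensated cutoff field and its divergence\<close>

definition horizontal :: "real^3 \<Rightarrow> real^3" where
  "horizontal w = vector [w $ 1, w $ 2, 0]"

lemma horizontal_nth [simp]: "horizontal w $ 1 = w $ 1" "horizontal w $ 2 = w $ 2" "horizontal w $ 3 = 0"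
  by (simp_all add: horizontal_def vector_3)

lemma bounded_linear_horizontal: "bounded_linear horizontal"
  unfolding linear_conv_bounded_linear[symmetric]
  by (rule linearI) (simp_all add: vec_eq_iff forall_3)

lemma norm_horizontal_le: "norm (horizontal w) \<le> norm w"
  by (simp add: norm_eq_sqrt_inner inner_vec_def sum_3)

text \<open>Cutting off creates the divergence \<^term>\<open>cutoff_deriv m (x $ 3) * g x $ 3\<close>; since
  \<^term>\<open>g x $ 3\<close> is minus the horizontal divergence of \<^term>\<open>x $ 3 *\<^sub>R ray_mean 0 g x\<close>,
  the second summand cancels it.\<close>

definition solenoidal_cutoff :: "real \<Rightarrow> (real^3 \<Rightarrow> real^3) \<Rightarrow> real^3 \<Rightarrow> real^3" where
  "solenoidal_cutoff m g x = cutoff m (x $ 3) *\<^sub>R g x + (x $ 3 * cutoff_deriv m (x $ 3)) *\<^sub>R horizontal (ray_mean 0 g x)"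

lemma smooth_compose_nth: "smooth h \<Longrightarrow> smooth (\<lambda>x::real^3. h (x $ i))"
  by (rule smooth_compose_linear[OF bounded_linear_vec_nth])

lemma smooth_horizontal_ray_mean: "smooth g \<Longrightarrow> smooth (\<lambda>x. horizontal (ray_mean 0 g x))"
  by (rule smooth_linear_compose[OF bounded_linear_horizontal smooth_ray_mean])

lemma smooth_solenoidal_cutoff: "smooth g \<Longrightarrow> smooth (solenoidal_cutoff m g)"
  unfolding solenoidal_cutoff_def[abs_def]
  by (intro smooth_add smooth_scaleR smooth_mult smooth_horizontal_ray_mean
      smooth_compose_nth[OF smooth_cutoff] smooth_compose_nth[OF smooth_cutoff_deriv]
      smooth_bounded_linear[OF bounded_linear_vec_nth])

lemma divergence_normal_mult:
  assumes h: "(h has_real_derivative h') (at (x $ 3))" and f: "f differentiable at x"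
  shows "divergence (\<lambda>x. h (x $ 3) *\<^sub>R f x) x = h' * f x $ 3 + h (x $ 3) * divergence f x"
proof -
  have "((\<lambda>x. h (x $ 3)) has_derivative (\<lambda>v. h' * v $ 3)) (at x)"
    by (rule has_derivative_compose[OF bounded_linear_imp_has_derivative[OF bounded_linear_vec_nth]])
      (use h in \<open>simp add: has_field_derivative_def\<close>)
  from has_derivative_scaleR[OF this differentiable_has_derivative_along[OF f]]
  have "deriv_along v (\<lambda>x. h (x $ 3) *\<^sub>R f x) x = h (x $ 3) *\<^sub>R deriv_along v f x + (h' * v $ 3) *\<^sub>R f x" for v
    by (rule deriv_along_eq)
  then show ?thesis
    by (simp add: divergence_def sum_3 axis_def algebra_simps)
qed

lemma divergence_horizontal:
  assumes "f differentiable at x"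
  shows "divergence (\<lambda>x. horizontal (f x)) x = deriv_along (axis 1 1) f x $ 1 + deriv_along (axis 2 1) f x $ 2"
  using deriv_along_eq[OF bounded_linear.has_derivative[OF bounded_linear_horizontal differentiable_has_derivative_along[OF assms]]]
  by (simp add: divergence_def sum_3)

lemma divergence_solenoidal_cutoff:
  assumes m: "0 < m" and g: "smooth g" and div: "\<And>x. x \<in> D_plus \<Longrightarrow> divergence g x = 0"
    and bd: "\<And>x. x $ 3 = 0 \<Longrightarrow> g x $ 3 = 0"
  shows "divergence (solenoidal_cutoff m g) x = 0"
proof -
  define h where "h z = z * cutoff_deriv m z" for z
  have h: "smooth h"
    unfolding h_def by (intro smooth_mult smooth_cutoff_deriv smooth_bounded_linear bounded_linear_ident)
  define f where "f x = horizontal (ray_mean 0 g x)" for x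
  have f: "smooth f" unfolding f_def by (rule smooth_horizontal_ray_mean[OF g])
  have d: "(\<lambda>x. cutoff m (x $ 3) *\<^sub>R g x) differentiable at x" "(\<lambda>x. h (x $ 3) *\<^sub>R f x) differentiable at x"
    by (intro smooth_differentiable smooth_scaleR smooth_compose_nth smooth_cutoff h f g)+
  have "divergence (solenoidal_cutoff m g) x = divergence (\<lambda>x. cutoff m (x $ 3) *\<^sub>R g x + h (x $ 3) *\<^sub>R f x) x"
    by (simp add: solenoidal_cutoff_def[abs_def] h_def f_def)
  also have "\<dots> = divergence (\<lambda>x. cutoff m (x $ 3) *\<^sub>R g x) x + divergence (\<lambda>x. h (x $ 3) *\<^sub>R f x) x"
    by (rule divergence_add[OF d])
  also have "divergence (\<lambda>x. cutoff m (x $ 3) *\<^sub>R g x) x = cutoff_deriv m (x $ 3) * g x $ 3 + cutoff m (x $ 3) * divergence g x"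
    by (rule divergence_normal_mult[OF cutoff_has_real_derivative smooth_differentiable[OF g]])
  also have "divergence (\<lambda>x. h (x $ 3) *\<^sub>R f x) x = deriv_along 1 h (x $ 3) * f x $ 3 + h (x $ 3) * divergence f x"
    by (rule divergence_normal_mult[OF smooth_has_real_derivative[OF h] smooth_differentiable[OF f]])
  \<comment> \<open>The derivative of z chi'(z), which contains chi'', meets only the normal
    component of the compensating field, and that component is zero.\<close>
  also have "f x $ 3 = 0" by (simp add: f_def)
  also have "divergence f x = deriv_along (axis 1 1) (ray_mean 0 g) x $ 1 + deriv_along (axis 2 1) (ray_mean 0 g) x $ 2"
    unfolding f_def by (rule divergence_horizontal[OF smooth_differentiable[OF smooth_ray_mean[OF g]]])
  finally have eq: "divergence (solenoidal_cutoff m g) x = cutoff_deriv m (x $ 3) * g x $ 3 + cutoff m (x $ 3) * divergence g x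
     + cutoff_deriv m (x $ 3) * (x $ 3 * (deriv_along (axis 1 1) (ray_mean 0 g) x $ 1 + deriv_along (axis 2 1) (ray_mean 0 g) x $ 2))"
    by (simp add: h_def)
  show ?thesis
  \<comment> \<open>Below the boundary g need not be solenoidal; there the cutoff and its derivative
    vanish.\<close>
  proof (cases "0 < x $ 3")
    case True
    then show ?thesis
      using horizontal_divergence_ray_mean[OF g div bd, of x] div[of x] unfolding eq by (simp add: D_plus_def)
  next
    case False
    then show ?thesis unfolding eq using cutoff_below[OF m, of "x $ 3"] by simp
  qed
qed

lemma periodic_ray_mean: "periodic_on UNIV periods g \<Longrightarrow> periodic_on UNIV periods (ray_mean k g)"
proof -
  have "squash s (x + v) = squash s x + v" if "v \<in> periods" for s x v
    using periods_nth_3[OF that] by (simp add: vec_eq_iff forall_3)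
  then show "periodic_on UNIV periods g \<Longrightarrow> periodic_on UNIV periods (ray_mean k g)"
    by (simp add: periodic_on_def ray_mean_def)
qed

lemma solenoidal_cutoff_below: "0 < m \<Longrightarrow> x $ 3 \<le> 0 \<Longrightarrow> solenoidal_cutoff m g x = 0"
  by (simp add: solenoidal_cutoff_def cutoff_below)

text \<open>For m > 0 each summand is defined on all of R^3 and vanishes on one closed half space.
  The sum is thus the extension of the cut off field, and its smoothness needs no gluing.\<close>

definition symmetrized_cutoff :: "real \<Rightarrow> (real^3 \<Rightarrow> real^3) \<Rightarrow> real^3 \<Rightarrow> real^3" where
  "symmetrized_cutoff m g x = solenoidal_cutoff m g x + reflect_field (solenoidal_cutoff m g) x"

lemma symmetrized_cutoff_test_field:
  assumes m: "1 \<le> m" and g: "g \<in> schwartz" and div: "\<And>x. x \<in> D_plus \<Longrightarrow> divergence g x = 0"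
    and bd: "\<And>x. x $ 3 = 0 \<Longrightarrow> g x $ 3 = 0"
  shows "symmetrized_cutoff m g \<in> test_fields_sol"
proof -
  let ?p = "solenoidal_cutoff m g"
  have sg: "smooth g" and pg: "periodic_on UNIV periods g" using g by (auto simp: schwartz_def)
  have sm: "smooth ?p" by (rule smooth_solenoidal_cutoff[OF sg])
  have smr: "smooth (reflect_field ?p)" by (rule smooth_reflect_field[OF sm])
  have "periodic_on UNIV periods ?p"
    using pg periodic_ray_mean[OF pg] by (simp add: periodic_on_def solenoidal_cutoff_def periods_nth_3)
  with periodic_reflect_field[OF this] have per: "periodic_on UNIV periods (symmetrized_cutoff m g)"
    by (simp add: periodic_on_def symmetrized_cutoff_def)
  have "?p x = 0" if "2 * m < \<bar>x $ 3\<bar>" for x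
    using that m cutoff_above[OF m, of "x $ 3"] solenoidal_cutoff_below[of m x]
    by (cases "0 < x $ 3") (auto simp: solenoidal_cutoff_def)
  then have "symmetrized_cutoff m g x = 0" if "2 * m < \<bar>x $ 3\<bar>" for x
    using that by (simp add: symmetrized_cutoff_def reflect_field_eq)
  moreover have "divergence (symmetrized_cutoff m g) x = 0" for x
    unfolding symmetrized_cutoff_def[abs_def]
    by (subst divergence_add)
      (use m in \<open>simp_all add: smooth_differentiable sm smr divergence_reflect_field divergence_solenoidal_cutoff[OF _ sg div bd]\<close>)
  moreover have "smooth (symmetrized_cutoff m g)"
    unfolding symmetrized_cutoff_def[abs_def] by (rule smooth_add[OF sm smr])
  ultimately show ?thesis using per by (auto simp: test_fields_sol_def test_fields_def)
qed

text \<open>The 1 comes from the factor 1 - chi on g and the 2B from z chi' on the average, both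
  fields being bounded by C/(1+z). The right-hand side does not involve m, so it can serve as a
  majorant.\<close>

lemma solenoidal_cutoff_dist:
  assumes g: "smooth g" and C: "\<And>x. norm (g x) \<le> C / (1 + \<bar>x $ 3\<bar>)\<^sup>2" "0 < C"
    and B: "\<And>y. \<bar>y * step_deriv y\<bar> \<le> B" "0 \<le> B" and m: "0 < m" and x: "0 \<le> x $ 3"
  shows "(norm (g x - solenoidal_cutoff m g x))\<^sup>2 \<le> ((1 + 2 * B) * C)\<^sup>2 * (1 / (1 + \<bar>x $ 3\<bar>)\<^sup>2)"
proof -
  have g1: "norm (g x) \<le> C / (1 + x $ 3)"
    using C(2) x by (intro order_trans[OF C(1)]) (auto intro!: divide_left_mono self_le_power)
  have "g x - solenoidal_cutoff m g x = (1 - cutoff m (x $ 3)) *\<^sub>R g x - (x $ 3 * cutoff_deriv m (x $ 3)) *\<^sub>R horizontal (ray_mean 0 g x)"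
    by (simp add: solenoidal_cutoff_def algebra_simps)
  also have "norm \<dots> \<le> \<bar>1 - cutoff m (x $ 3)\<bar> * norm (g x) + \<bar>x $ 3 * cutoff_deriv m (x $ 3)\<bar> * norm (horizontal (ray_mean 0 g x))"
    by (rule order_trans[OF norm_triangle_ineq4]) simp
  also have "\<dots> \<le> 1 * (C / (1 + x $ 3)) + (2 * B) * (C / (1 + x $ 3))"
    using cutoff_bounds[of m "x $ 3"] B(2) C(2) x
    by (intro add_mono mult_mono g1 cutoff_deriv_bound[OF B(1) m]
        order_trans[OF norm_horizontal_le] ray_mean_bound[OF g C(1) x]) auto
  also have "\<dots> = (1 + 2 * B) * C / (1 + x $ 3)" by (simp add: add_divide_distrib distrib_right)
  finally have "(norm (g x - solenoidal_cutoff m g x))\<^sup>2 \<le> ((1 + 2 * B) * C / (1 + x $ 3))\<^sup>2"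
    by (rule power_mono) simp
  then show ?thesis using x by (simp add: power_divide)
qed

section \<open>Convergence of the cutoffs and membership of the extension in H_sigma(D)\<close>

lemma AE_vol_D_plus_interior: "AE x in vol D_plus. 0 < x $ 3"
  unfolding vol_def using AE_off_boundary D_plus_cell_sets
  by (auto simp: AE_restrict_space_iff D_plus_def elim!: eventually_mono)

text \<open>Dominated convergence: at each interior point the cutoff is eventually exactly 1 with
  derivative 0, so the difference is eventually 0. The index \<open>Suc n\<close> keeps the
  parameter at least 1.\<close>

lemma solenoidal_cutoff_converges:
  assumes g: "g \<in> schwartz"
  shows "\<And>n. integrable (vol D_plus) (\<lambda>x. (norm (g x - solenoidal_cutoff (real (Suc n)) g x))\<^sup>2)"
    and "(\<lambda>n. \<integral>x. (norm (g x - solenoidal_cutoff (real (Suc n)) g x))\<^sup>2 \<partial>vol D_plus) \<longlonglongrightarrow> 0"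
proof -
  have sg: "smooth g" using g by (simp add: schwartz_def)
  obtain C where C: "0 < C" "\<And>x. norm (g x) \<le> C / (1 + \<bar>x $ 3\<bar>)\<^sup>2" using schwartz_bound[OF g] by blast
  obtain B where B: "0 \<le> B" "\<And>y. \<bar>y * step_deriv y\<bar> \<le> B" using step_deriv_bound by blast
  define F where "F n x = (norm (g x - solenoidal_cutoff (real (Suc n)) g x))\<^sup>2" for n x
  define W where "W x = ((1 + 2 * B) * C)\<^sup>2 * (1 / (1 + \<bar>x $ 3\<bar>)\<^sup>2)" for x :: "real^3"
  have W: "integrable (vol D_plus) W"
    unfolding W_def by (rule integrable_mult_right[OF integrable_decay])
  have FW: "AE x in vol D_plus. norm (F n x) \<le> W x" for n
    using AE_vol_D_plus_interior
  proof eventually_elim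
    case (elim x)
    then show ?case
      using solenoidal_cutoff_dist[OF sg C(2,1) B(2,1), of "real (Suc n)" x] by (simp add: F_def W_def)
  qed
  have F: "F n \<in> borel_measurable (vol D_plus)" for n
    unfolding F_def
    by (intro borel_measurable_vol_continuous continuous_intros smooth_continuous_on smooth_solenoidal_cutoff sg)
  have lim: "AE x in vol D_plus. (\<lambda>n. F n x) \<longlonglongrightarrow> 0"
    using AE_vol_D_plus_interior
  proof eventually_elim
    case (elim x)
    \<comment> \<open>Beyond both thresholds, 2 < m x_3 and x_3 < m hold, so x lies on the
      plateau.\<close>
    obtain N where N: "max (2 / x $ 3) (x $ 3) < real N" using reals_Archimedean2 by blast
    have "F n x = 0" if "N \<le> n" for n
    proof -
      have "2 / x $ 3 < real (Suc n)" "x $ 3 < real (Suc n)" using N that by auto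
      then have "cutoff (real (Suc n)) (x $ 3) = 1" "cutoff_deriv (real (Suc n)) (x $ 3) = 0"
        using cutoff_middle[of "real (Suc n)" "x $ 3"] elim by (auto simp: pos_divide_less_eq)
      then show ?thesis by (simp add: F_def solenoidal_cutoff_def)
    qed
    then show ?case by (intro tendsto_eventually eventually_sequentiallyI[of N])
  qed
  show "integrable (vol D_plus) (\<lambda>x. (norm (g x - solenoidal_cutoff (real (Suc n)) g x))\<^sup>2)" for n
    using integrable_dominated_convergence2[OF _ F W lim FW] by (simp add: F_def)
  show "(\<lambda>n. \<integral>x. (norm (g x - solenoidal_cutoff (real (Suc n)) g x))\<^sup>2 \<partial>vol D_plus) \<longlonglongrightarrow> 0"
    using integral_dominated_convergence[OF _ F W lim FW] by (simp add: F_def)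
qed

lemma L2_uminus: "f \<in> L2 \<Omega> \<Longrightarrow> (\<lambda>x. - f x) \<in> L2 \<Omega>"
  by (auto simp: L2_def periodic_on_def)

lemma extend_field_H_full:
  assumes f: "f \<in> H_plus"
  shows "extend_field f \<in> H_full"
proof -
  have fL: "f \<in> L2 D_plus" using f by (simp add: H_plus_def L2_closure_def)
  have "\<exists>h\<in>test_fields_sol. L2_norm D_full (\<lambda>x. extend_field f x - h x) < e" if e: "0 < e" for e :: real
  proof -
    \<comment> \<open>Two errors with squared norm below e^2/16, each doubled by |a+b|^2 <= 2|a|^2 +
      2|b|^2, give e^2/4 on the half space; the reflected half doubles this to e^2/2 < e^2.\<close>
    obtain g where g: "g \<in> schwartz" and div: "\<And>x. x \<in> D_plus \<Longrightarrow> divergence g x = 0"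
      and bd: "\<And>x. x $ 3 = 0 \<Longrightarrow> g x $ 3 = 0" and fg: "L2_norm D_plus (\<lambda>x. f x - g x) < e / 4"
      using f e by (auto simp: H_plus_def L2_closure_def elim!: allE[of _ "e / 4"])
    let ?p = "\<lambda>n. solenoidal_cutoff (real (Suc n)) g"
    obtain n where n: "(\<integral>x. (norm (g x - ?p n x))\<^sup>2 \<partial>vol D_plus) < e\<^sup>2 / 16"
      using order_tendstoD(2)[OF solenoidal_cutoff_converges(2)[OF g], of "e\<^sup>2 / 16"] e
      by (auto simp: eventually_sequentially)
    have gL: "g \<in> L2 D_plus" by (rule L2_D_full_imp_D_plus[OF schwartz_L2[OF g]])
    have fg_int: "integrable (vol D_plus) (\<lambda>x. (norm (f x - g x))\<^sup>2)"
      using L2_add[OF fL L2_uminus[OF gL]] by (simp add: L2_def)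
    have "(L2_norm D_plus (\<lambda>x. f x - g x))\<^sup>2 < (e / 4)\<^sup>2"
      using fg by (intro power_strict_mono) (auto simp: L2_norm_def)
    then have fg2: "(\<integral>x. (norm (f x - g x))\<^sup>2 \<partial>vol D_plus) < e\<^sup>2 / 16"
      by (simp add: L2_norm_def power_divide)
    have le: "(norm (f x - ?p n x))\<^sup>2 \<le> 2 * (norm (f x - g x))\<^sup>2 + 2 * (norm (g x - ?p n x))\<^sup>2" for x
      using norm_add_square_le[of "f x - g x" "g x - ?p n x"] by simp
    have int: "integrable (vol D_plus) (\<lambda>x. 2 * (norm (f x - g x))\<^sup>2 + 2 * (norm (g x - ?p n x))\<^sup>2)"
      using fg_int solenoidal_cutoff_converges(1)[OF g] by simp
    have pm: "?p n \<in> borel_measurable (vol D_plus)"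
      using g by (intro borel_measurable_vol_continuous smooth_continuous_on smooth_solenoidal_cutoff) (simp add: schwartz_def)
    have m: "(\<lambda>x. f x - ?p n x) \<in> borel_measurable (vol D_plus)"
      using fL by (intro borel_measurable_diff pm) (simp add: L2_def)
    have fp: "integrable (vol D_plus) (\<lambda>x. (norm (f x - ?p n x))\<^sup>2)"
    proof (rule Bochner_Integration.integrable_bound[OF int])
      show "(\<lambda>x. (norm (f x - ?p n x))\<^sup>2) \<in> borel_measurable (vol D_plus)" using m by measurable
      show "AE x in vol D_plus. norm ((norm (f x - ?p n x))\<^sup>2) \<le> norm (2 * (norm (f x - g x))\<^sup>2 + 2 * (norm (g x - ?p n x))\<^sup>2)"
        by (intro AE_I2) (use le in \<open>simp del: of_nat_Suc\<close>)
    qed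
    have "(\<integral>x. (norm (f x - ?p n x))\<^sup>2 \<partial>vol D_plus)
        \<le> (\<integral>x. 2 * (norm (f x - g x))\<^sup>2 + 2 * (norm (g x - ?p n x))\<^sup>2 \<partial>vol D_plus)"
      by (rule integral_mono[OF fp int le])
    also have "\<dots> = 2 * (\<integral>x. (norm (f x - g x))\<^sup>2 \<partial>vol D_plus) + 2 * (\<integral>x. (norm (g x - ?p n x))\<^sup>2 \<partial>vol D_plus)"
      using fg_int solenoidal_cutoff_converges(1)[OF g] by simp
    finally have small: "(\<integral>x. (norm (f x - ?p n x))\<^sup>2 \<partial>vol D_plus) < e\<^sup>2 / 4" using fg2 n by linarith
    let ?h = "symmetrized_cutoff (real (Suc n)) g"
    have "has_bochner_integral (vol D_full) (\<lambda>x. (norm (extend_field f x - ?h x))\<^sup>2)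
        ((\<integral>x. (norm (f x - ?p n x))\<^sup>2 \<partial>vol D_plus) + (\<integral>x. (norm (f x - ?p n x))\<^sup>2 \<partial>vol D_plus))"
      by (rule has_bochner_integral_full[OF has_bochner_integral_integrable[OF fp] has_bochner_integral_integrable[OF fp]])
        (simp_all add: extend_field_upper extend_field_lower symmetrized_cutoff_def reflect_field_eq
          solenoidal_cutoff_below mirror_diff[symmetric] del: of_nat_Suc)
    then have "(\<integral>x. (norm (extend_field f x - ?h x))\<^sup>2 \<partial>vol D_full) < e\<^sup>2"
      using small e by (simp add: has_bochner_integral_iff) (smt (verit) zero_less_power)
    then have "L2_norm D_full (\<lambda>x. extend_field f x - ?h x) < e"
      unfolding L2_norm_def using e real_sqrt_less_mono by fastforce
    moreover have "?h \<in> test_fields_sol"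
      by (rule symmetrized_cutoff_test_field[OF _ g div bd]) simp_all
    ultimately show ?thesis by blast
  qed
  then show ?thesis using L2_extend_field[OF fL] by (simp add: H_full_def L2_closure_def)
qed


section \<open>The weak formulation\<close>

text \<open>No measurability of g is assumed: completeness supplies it. This is needed for functions
  of time whose values are identified only where the space integrals converge.\<close>

lemma has_bochner_integral_lebesgue_on_AE:
  fixes f g :: "'a::euclidean_space \<Rightarrow> 'b::euclidean_space"
  assumes S: "S \<in> sets lebesgue" and f: "has_bochner_integral (lebesgue_on S) f i"
    and ae: "AE x in lebesgue_on S. f x = g x"
  shows "has_bochner_integral (lebesgue_on S) g i"
proof -
  have f': "has_bochner_integral lebesgue (\<lambda>x. indicator S x *\<^sub>R f x) i"
    using f S by (simp add: has_bochner_integral_restrict_space)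
  have ae': "AE x in lebesgue. indicator S x *\<^sub>R f x = indicator S x *\<^sub>R g x"
    using ae S by (auto simp: AE_restrict_space_iff indicator_def elim!: eventually_mono)
  have "(\<lambda>x. indicator S x *\<^sub>R f x) \<in> borel_measurable lebesgue"
    using f' by (auto simp: has_bochner_integral.simps)
  with borel_measurable_AE[OF this ae'] have "has_bochner_integral lebesgue (\<lambda>x. indicator S x *\<^sub>R g x) i"
    using f' ae' has_bochner_integral_cong_AE by blast
  then show ?thesis using S by (simp add: has_bochner_integral_restrict_space)
qed

text \<open>The splitting in space is applied at almost every time, namely where both half-space
  integrands are integrable, and the resulting sums are then integrated in time.\<close>

lemma has_iterated_integral_full:
  assumes G: "has_iterated_integral D_plus t G I" and G': "has_iterated_integral D_plus t G' I'"
    and F: "\<And>\<tau> x. 0 < x $ 3 \<Longrightarrow> F \<tau> x = G \<tau> x" "\<And>\<tau> x. 0 < x $ 3 \<Longrightarrow> F \<tau> (mirror x) = G' \<tau> x"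
  shows "has_iterated_integral D_full t F (I + I')"
proof -
  have ae: "AE \<tau> in lebesgue_on {0..t}. has_bochner_integral (vol D_full) (F \<tau>) (integral\<^sup>L (vol D_plus) (G \<tau>) + integral\<^sup>L (vol D_plus) (G' \<tau>))"
    using conjunct1[OF G[unfolded has_iterated_integral_def]] conjunct1[OF G'[unfolded has_iterated_integral_def]]
  proof eventually_elim
    case (elim \<tau>)
    show ?case
      by (rule has_bochner_integral_full[OF has_bochner_integral_integrable[OF elim(1)] has_bochner_integral_integrable[OF elim(2)] F])
  qed
  have sum: "has_bochner_integral (lebesgue_on {0..t}) (\<lambda>\<tau>. integral\<^sup>L (vol D_plus) (G \<tau>) + integral\<^sup>L (vol D_plus) (G' \<tau>)) (I + I')"
    using G G' by (intro has_bochner_integral_add) (auto simp: has_iterated_integral_def)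
  have "AE \<tau> in lebesgue_on {0..t}.
      integral\<^sup>L (vol D_plus) (G \<tau>) + integral\<^sup>L (vol D_plus) (G' \<tau>) = integral\<^sup>L (vol D_full) (F \<tau>)"
    by (rule eventually_mono[OF ae]) (simp add: has_bochner_integral_iff)
  from has_bochner_integral_lebesgue_on_AE[OF _ sum this]
  have "has_bochner_integral (lebesgue_on {0..t}) (\<lambda>\<tau>. integral\<^sup>L (vol D_full) (F \<tau>)) (I + I')"
    by simp
  moreover have "AE \<tau> in lebesgue_on {0..t}. integrable (vol D_full) (F \<tau>)"
    by (rule eventually_mono[OF ae]) (simp add: has_bochner_integral_iff)
  ultimately show ?thesis by (simp add: has_iterated_integral_def)
qed

text \<open>Additivity of the space integral holds at times where both integrands are integrable,
  and these form a set of full measure.\<close>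

lemma has_iterated_integral_add:
  assumes G: "has_iterated_integral \<Omega> t G I" and G': "has_iterated_integral \<Omega> t G' I'"
  shows "has_iterated_integral \<Omega> t (\<lambda>\<tau> x. G \<tau> x + G' \<tau> x) (I + I')"
proof -
  have ae: "AE \<tau> in lebesgue_on {0..t}. integrable (vol \<Omega>) (G \<tau>) \<and> integrable (vol \<Omega>) (G' \<tau>)"
    using G G' by (auto simp: has_iterated_integral_def)
  have sum: "has_bochner_integral (lebesgue_on {0..t}) (\<lambda>\<tau>. integral\<^sup>L (vol \<Omega>) (G \<tau>) + integral\<^sup>L (vol \<Omega>) (G' \<tau>)) (I + I')"
    using G G' by (intro has_bochner_integral_add) (auto simp: has_iterated_integral_def)
  have "AE \<tau> in lebesgue_on {0..t}.
      integral\<^sup>L (vol \<Omega>) (G \<tau>) + integral\<^sup>L (vol \<Omega>) (G' \<tau>) = (\<integral>x. G \<tau> x + G' \<tau> x \<partial>vol \<Omega>)"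
    by (rule eventually_mono[OF ae]) simp
  from has_bochner_integral_lebesgue_on_AE[OF _ sum this]
  have "has_bochner_integral (lebesgue_on {0..t}) (\<lambda>\<tau>. \<integral>x. G \<tau> x + G' \<tau> x \<partial>vol \<Omega>) (I + I')"
    by simp
  moreover have "AE \<tau> in lebesgue_on {0..t}. integrable (vol \<Omega>) (\<lambda>x. G \<tau> x + G' \<tau> x)"
    by (rule eventually_mono[OF ae]) simp
  ultimately show ?thesis by (simp add: has_iterated_integral_def)
qed

lemma has_iterated_integral_unique:
  "has_iterated_integral \<Omega> t F I \<Longrightarrow> has_iterated_integral \<Omega> t F J \<Longrightarrow> I = J"
  unfolding has_iterated_integral_def using has_bochner_integral_eq by blast

section \<open>Reflected test fields and the boundary term\<close>

definition reflect_spacetime :: "((real^3) \<times> real \<Rightarrow> real^3) \<Rightarrow> (real^3) \<times> real \<Rightarrow> real^3" where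
  "reflect_spacetime \<psi> z = mirror (\<psi> (mirror (fst z), snd z))"

lemma reflect_spacetime_slice: "(\<lambda>x. reflect_spacetime \<psi> (x, t)) = reflect_field (\<lambda>x. \<psi> (x, t))"
  by (simp add: reflect_spacetime_def reflect_field_eq fun_eq_iff)

lemma bounded_linear_mirror_fst: "bounded_linear (\<lambda>z. (mirror (fst z), snd z))"
  by (intro bounded_linear_Pair bounded_linear_compose[OF bounded_linear_mirror] bounded_linear_fst bounded_linear_snd)

lemma smooth_reflect_spacetime: "smooth \<psi> \<Longrightarrow> smooth (reflect_spacetime \<psi>)"
  unfolding reflect_spacetime_def[abs_def]
  by (rule smooth_linear_compose[OF bounded_linear_mirror smooth_compose_linear[OF bounded_linear_mirror_fst]])

lemma deriv_along_reflect_spacetime: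
  assumes "smooth \<psi>"
  shows "deriv_along (0, 1) (reflect_spacetime \<psi>) (x, \<tau>) = mirror (deriv_along (0, 1) \<psi> (mirror x, \<tau>))"
proof -
  have "((\<lambda>z. \<psi> (mirror (fst z), snd z)) has_derivative (\<lambda>w. deriv_along (mirror (fst w), snd w) \<psi> (mirror x, \<tau>))) (at (x, \<tau>))"
    by (rule has_derivative_compose[OF bounded_linear_imp_has_derivative[OF bounded_linear_mirror_fst]])
      (use smooth_has_derivative[OF assms] in simp)
  from deriv_along_eq[OF bounded_linear.has_derivative[OF bounded_linear_mirror this], of "(0, 1)"]
  show ?thesis by (simp add: reflect_spacetime_def[abs_def])
qed

lemma smooth_slice: "smooth \<psi> \<Longrightarrow> smooth (\<lambda>x. \<psi> (x, t))"
  using smooth_compose_affine[of "\<lambda>x. (x, 0)" \<psi> "(0, t)"]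
  by (simp add: bounded_linear_Pair bounded_linear_ident bounded_linear_zero)

lemma schwartz_sol_full_iff: "\<phi> \<in> schwartz_sol D_full \<longleftrightarrow> \<phi> \<in> schwartz \<and> (\<forall>x. divergence \<phi> x = 0)"
proof
  assume "\<phi> \<in> schwartz_sol D_full"
  then obtain \<Phi> where \<Phi>: "\<Phi> \<in> schwartz" "\<forall>x. divergence \<Phi> x = 0" "\<forall>x. \<phi> x = \<Phi> x"
    by (auto simp: schwartz_sol_def D_full_def)
  then have "\<phi> = \<Phi>" by auto
  with \<Phi> show "\<phi> \<in> schwartz \<and> (\<forall>x. divergence \<phi> x = 0)" by simp
qed (auto simp: schwartz_sol_def)

text \<open>Each time slice serves as its own solenoidal extension from the half space.\<close>

lemma spacetime_tests_full_imp_plus: "\<psi> \<in> spacetime_tests D_full T \<Longrightarrow> \<psi> \<in> spacetime_tests D_plus T"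
  unfolding spacetime_tests_def schwartz_sol_def by (fastforce simp: D_full_def)

lemma spacetime_tests_reflect:
  assumes "\<psi> \<in> spacetime_tests D_full T"
  shows "reflect_spacetime \<psi> \<in> spacetime_tests D_full T"
proof -
  have sm: "smooth \<psi>" and per: "periodic_on UNIV ((\<lambda>v. (v, 0)) ` periods) \<psi>"
    and sl: "\<And>t. t \<in> {0..T} \<Longrightarrow> (\<lambda>x. \<psi> (x, t)) \<in> schwartz_sol D_full"
    using assms by (auto simp: spacetime_tests_def)
  have "periodic_on UNIV ((\<lambda>v. (v, 0)) ` periods) (reflect_spacetime \<psi>)"
    unfolding periodic_on_def
  proof (intro ballI)
    fix w z assume "w \<in> (\<lambda>v. (v, 0::real)) ` periods"
    then obtain v where v: "v \<in> periods" "w = (v, 0)" by auto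
    have "\<psi> ((mirror (fst z), snd z) + (v, 0)) = \<psi> (mirror (fst z), snd z)"
      using per v(1) unfolding periodic_on_def by blast
    then show "reflect_spacetime \<psi> (z + w) = reflect_spacetime \<psi> z"
      by (simp add: reflect_spacetime_def v(2) mirror_add mirror_periods[OF v(1)])
  qed
  moreover have "(\<lambda>x. reflect_spacetime \<psi> (x, t)) \<in> schwartz_sol D_full" if "t \<in> {0..T}" for t
    using sl[OF that] smooth_differentiable[OF smooth_slice[OF sm]]
    by (simp add: reflect_spacetime_slice schwartz_sol_full_iff schwartz_reflect_field divergence_reflect_field)
  ultimately show ?thesis
    using smooth_reflect_spacetime[OF sm] by (simp add: spacetime_tests_def)
qed

lemma spacetime_tests_add:
  assumes "\<psi> \<in> spacetime_tests D_full T" "\<psi>' \<in> spacetime_tests D_full T"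
  shows "(\<lambda>z. \<psi> z + \<psi>' z) \<in> spacetime_tests D_full T"
proof -
  have sm: "smooth \<psi>" "smooth \<psi>'" using assms by (auto simp: spacetime_tests_def)
  then show ?thesis
    using assms smooth_add[OF sm] smooth_differentiable[OF smooth_slice[OF sm(1)]] smooth_differentiable[OF smooth_slice[OF sm(2)]]
    by (simp add: spacetime_tests_def periodic_on_def schwartz_sol_full_iff schwartz_add divergence_add)
qed

text \<open>Cutting off the zero function leaves it zero, so along any existing cutoff sequence the
  limit L is that of the constant p(0) = 0, by linearity with both coefficients 0.\<close>

lemma boundary_pairing_zero:
  assumes p: "boundary_distribution T p" and L: "has_boundary_pairing p (\<lambda>_. 0) t L"
  shows "L = 0"
proof -
  have "(\<lambda>_. 0) \<in> boundary_tests"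
    by (simp add: boundary_tests_def smooth_const periodic_on_def)
  with conjunct1[OF p[unfolded boundary_distribution_def], rule_format, of "\<lambda>_. 0" "\<lambda>_. 0" 0 0]
  have p0: "p (\<lambda>_. 0) = 0" by simp
  obtain \<eta> where "time_cutoffs t \<eta>" using time_cutoffs_exist by blast
  then have "(\<lambda>n. p (\<lambda>(y, \<tau>). \<eta> n \<tau> * 0)) \<longlonglongrightarrow> L"
    using L unfolding has_boundary_pairing_def by blast
  then show ?thesis by (simp add: p0 LIMSEQ_const_iff split_def)
qed

text \<open>Boundary points are fixed by \<open>mirror\<close>, so there the reflection merely flips
  the normal component and the two contributions cancel.\<close>

lemma normal_trace_symmetrized: "normal_trace (\<lambda>z. \<psi> z + reflect_spacetime \<psi> z) = (\<lambda>_. 0)"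
proof -
  have "mirror (boundary_point y) = boundary_point y" for y
    by (simp add: vec_eq_iff forall_3 boundary_point_def vector_3)
  then show ?thesis
    by (simp add: normal_trace_def reflect_spacetime_def fun_eq_iff inner_vec_def sum_3 outer_normal_def vector_3)
qed

section \<open>Transfer of the integrands to the half space\<close>

lemma time_term_extend:
  assumes "smooth \<psi>" "0 < x $ 3"
  shows "time_term (\<lambda>t. extend_field (u t)) \<psi> \<tau> x = time_term u \<psi> \<tau> x"
    and "time_term (\<lambda>t. extend_field (u t)) \<psi> \<tau> (mirror x) = time_term u (reflect_spacetime \<psi>) \<tau> x"
  using assms by (simp_all add: time_term_def extend_field_upper extend_field_lower
      deriv_along_reflect_spacetime inner_mirror_left)

text \<open>Write e_i for the sign of \<open>mirror\<close> on the i-th axis. Reflecting the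
  velocity multiplies u_i u_j by e_i e_j, and the derivative d_i of the j-th component of the
  reflected test field carries the same factor, one sign from the direction and one from the
  component.\<close>

lemma convection_term_extend:
  assumes "smooth \<psi>" "0 < x $ 3"
  shows "convection_term (\<lambda>t. extend_field (u t)) \<psi> \<tau> x = convection_term u \<psi> \<tau> x"
    and "convection_term (\<lambda>t. extend_field (u t)) \<psi> \<tau> (mirror x) = convection_term u (reflect_spacetime \<psi>) \<tau> x"
proof -
  have d: "(\<lambda>x. \<psi> (x, \<tau>)) differentiable at x" for x
    by (rule smooth_differentiable[OF smooth_slice[OF assms(1)]])
  show "convection_term (\<lambda>t. extend_field (u t)) \<psi> \<tau> x = convection_term u \<psi> \<tau> x"
    using assms(2) by (simp add: convection_term_def extend_field_upper)
  show "convection_term (\<lambda>t. extend_field (u t)) \<psi> \<tau> (mirror x) = convection_term u (reflect_spacetime \<psi>) \<tau> x"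
    using assms(2) deriv_along_eq[OF deriv_along_reflect_field[OF d]]
    by (simp add: convection_term_def extend_field_lower sum_3 reflect_spacetime_slice mirror_axis deriv_along_minus[OF d])
qed

lemma time_term_add:
  "smooth \<psi> \<Longrightarrow> smooth \<psi>' \<Longrightarrow> time_term u (\<lambda>z. \<psi> z + \<psi>' z) = (\<lambda>\<tau> x. time_term u \<psi> \<tau> x + time_term u \<psi>' \<tau> x)"
  by (simp add: time_term_def fun_eq_iff deriv_along_add smooth_differentiable inner_add_right)

lemma convection_term_add:
  "smooth \<psi> \<Longrightarrow> smooth \<psi>' \<Longrightarrow>
    convection_term u (\<lambda>z. \<psi> z + \<psi>' z) = (\<lambda>\<tau> x. convection_term u \<psi> \<tau> x + convection_term u \<psi>' \<tau> x)"
  by (simp add: convection_term_def fun_eq_iff deriv_along_add smooth_differentiable smooth_slice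
      distrib_left sum.distrib)

theorem corollary14:
  fixes T :: real
    and u :: "real \<Rightarrow> real^3 \<Rightarrow> real^3"
    and p :: "((real^2) \<times> real \<Rightarrow> real) \<Rightarrow> real"
  assumes "T > 0"
    and "weak_Euler_solution_plus T u p"
  shows "weak_Euler_solution_full T (\<lambda>t. extend_field (u t))"
proof -
  have wc: "weakly_continuous D_plus H_plus T u" and bd: "boundary_distribution T p"
    and weak: "\<And>t \<phi>. t \<in> {0..T} \<Longrightarrow> \<phi> \<in> spacetime_tests D_plus T \<Longrightarrow> \<exists>I J L.
        has_iterated_integral D_plus t (time_term u \<phi>) I \<and>
        has_iterated_integral D_plus t (convection_term u \<phi>) J \<and>
        has_boundary_pairing p (normal_trace \<phi>) t L \<and>
        L2_inner D_plus (u t) (\<lambda>x. \<phi> (x, t)) - L2_inner D_plus (u 0) (\<lambda>x. \<phi> (x, 0)) - I = J - L"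
    using assms(2) unfolding weak_Euler_solution_plus_def by blast+
  have uH: "u t \<in> H_plus" if "t \<in> {0..T}" for t
    using wc that by (simp add: weakly_continuous_def)
  have uL: "u t \<in> L2 D_plus" if "t \<in> {0..T}" for t
    using uH[OF that] by (simp add: H_plus_def L2_closure_def)
  have "continuous_on {0..T} (\<lambda>t. L2_inner D_full (extend_field (u t)) \<phi>)" if \<phi>: "\<phi> \<in> L2 D_full" for \<phi>
  proof -
    have "continuous_on {0..T} (\<lambda>t. L2_inner D_plus (u t) \<phi> + L2_inner D_plus (u t) (reflect_field \<phi>))"
      using wc \<phi> by (intro continuous_on_add)
        (auto simp: weakly_continuous_def L2_D_full_imp_D_plus L2_reflect_field)
    then show ?thesis
      by (rule continuous_on_eq) (simp add: L2_inner_extend_field uL \<phi>)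
  qed
  then have "weakly_continuous D_full H_full T (\<lambda>t. extend_field (u t))"
    using uH by (simp add: weakly_continuous_def extend_field_H_full)
  moreover have "\<exists>I J.
        has_iterated_integral D_full t (time_term (\<lambda>t. extend_field (u t)) \<psi>) I \<and>
        has_iterated_integral D_full t (convection_term (\<lambda>t. extend_field (u t)) \<psi>) J \<and>
        L2_inner D_full (extend_field (u t)) (\<lambda>x. \<psi> (x, t)) - L2_inner D_full (extend_field (u 0)) (\<lambda>x. \<psi> (x, 0)) - I = J"
    if t: "t \<in> {0..T}" and \<psi>: "\<psi> \<in> spacetime_tests D_full T" for t \<psi>
  proof -
    have \<psi>R: "reflect_spacetime \<psi> \<in> spacetime_tests D_full T" by (rule spacetime_tests_reflect[OF \<psi>])
    have sm: "smooth \<psi>" "smooth (reflect_spacetime \<psi>)" using \<psi> \<psi>R by (auto simp: spacetime_tests_def)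
    let ?S = "\<lambda>z. \<psi> z + reflect_spacetime \<psi> z"
    \<comment> \<open>From the tests with \<open>\<psi>\<close> and with its reflection only the
      existence of the integrals is kept; the balance is taken from the test with the sum, whose
      normal trace is identically zero.\<close>
    obtain I J where 1: "has_iterated_integral D_plus t (time_term u \<psi>) I"
      "has_iterated_integral D_plus t (convection_term u \<psi>) J"
      using weak[OF t spacetime_tests_full_imp_plus[OF \<psi>]] by blast
    obtain I' J' where 2: "has_iterated_integral D_plus t (time_term u (reflect_spacetime \<psi>)) I'"
      "has_iterated_integral D_plus t (convection_term u (reflect_spacetime \<psi>)) J'"
      using weak[OF t spacetime_tests_full_imp_plus[OF \<psi>R]] by blast
    obtain I'' J'' L where 3: "has_iterated_integral D_plus t (time_term u ?S) I''"
      "has_iterated_integral D_plus t (convection_term u ?S) J''"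
      "has_boundary_pairing p (normal_trace ?S) t L"
      "L2_inner D_plus (u t) (\<lambda>x. ?S (x, t)) - L2_inner D_plus (u 0) (\<lambda>x. ?S (x, 0)) - I'' = J'' - L"
      using weak[OF t spacetime_tests_full_imp_plus[OF spacetime_tests_add[OF \<psi> \<psi>R]]] by blast
    have "L = 0" using boundary_pairing_zero[OF bd] 3(3) by (simp add: normal_trace_symmetrized)
    moreover have "I'' = I + I'"
      \<comment> \<open>The integral for the sum is computed in two ways: as supplied by the weak
        formulation and as the sum of the two separate integrals.\<close>
      by (rule has_iterated_integral_unique[OF 3(1)[unfolded time_term_add[OF sm]] has_iterated_integral_add[OF 1(1) 2(1)]])
    moreover have "J'' = J + J'"
      by (rule has_iterated_integral_unique[OF 3(2)[unfolded convection_term_add[OF sm]] has_iterated_integral_add[OF 1(2) 2(2)]])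
    moreover have "L2_inner D_full (extend_field (u s)) (\<lambda>x. \<psi> (x, s)) = L2_inner D_plus (u s) (\<lambda>x. ?S (x, s))"
      if s: "s \<in> {0..T}" for s
    proof -
      have "(\<lambda>x. \<psi> (x, s)) \<in> schwartz"
        using \<psi> s by (simp add: spacetime_tests_def schwartz_sol_full_iff)
      then have L2: "(\<lambda>x. \<psi> (x, s)) \<in> L2 D_full" by (rule schwartz_L2)
      have "L2_inner D_plus (u s) (\<lambda>x. ?S (x, s)) = L2_inner D_plus (u s) (\<lambda>x. \<psi> (x, s) + reflect_field (\<lambda>x. \<psi> (x, s)) x)"
        by (simp add: reflect_spacetime_slice[symmetric])
      also have "\<dots> = L2_inner D_plus (u s) (\<lambda>x. \<psi> (x, s)) + L2_inner D_plus (u s) (reflect_field (\<lambda>x. \<psi> (x, s)))"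
        by (rule L2_inner_add_right[OF uL[OF s] L2_D_full_imp_D_plus[OF L2] L2_D_full_imp_D_plus[OF L2_reflect_field[OF L2]]])
      finally show ?thesis by (simp add: L2_inner_extend_field[OF uL[OF s] L2])
    qed
    moreover have "has_iterated_integral D_full t (time_term (\<lambda>t. extend_field (u t)) \<psi>) (I + I')"
      by (rule has_iterated_integral_full[OF 1(1) 2(1)]) (simp_all add: time_term_extend sm)
    moreover have "has_iterated_integral D_full t (convection_term (\<lambda>t. extend_field (u t)) \<psi>) (J + J')"
      by (rule has_iterated_integral_full[OF 1(2) 2(2)]) (simp_all add: convection_term_extend sm)
    \<comment> \<open>The identity of inner products is used at s = t and at s = 0.\<close>
    ultimately show ?thesis using 3(4) t assms(1) by auto
  qed
  ultimately show ?thesis by (simp add: weak_Euler_solution_full_def)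
qed

end
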